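(* Let $\mathcal{A}$ be a finite set and let $E\in\mathbb{R}_{\ge 0}^{\mathcal{A}\times\mathcal{A}}$ be an interaction matrix, $E_{a,b}=w_aA_{a,b}$ with $w\in\mathbb{R}_{\ge0}^{\mathcal{A}}$ and $A\in\mathbb{R}_{\ge0}^{\mathcal{A}\times\mathcal{A}}$, such that $\sum_{a\in\mathcal{A}}E_{a,b}>0$ for every $b\in\mathcal{A}$ and $\sum_{b\in\mathcal{A}}E_{a,b}>0$ for every $a\in\mathcal{A}$. For real $d>1$ let $P^{(\infty)}(d,E)$ be the maximum of the optimization problem described in the context, and for integers $d\ge 2$ let $\mathbf{P}(X_E^{\times d},E)$ be the topological pressure of the isotropic axial product $X_E^{\times d}$ on the $d$-tree. Then: (a) the function $d\mapsto P^{(\infty)}(d,E)$ is continuous and increasing on $(1,\infty)$; (b) $P^{(\infty)}(d,E)=\mathbf{P}(X_E^{\times d},E)$ for all $d\in\mathbb{N}\setminus\{1\}$; (c) with $\rho(E)$ the spectral radius of $E$ and $r_E=\max\{\sum_{a\in\mathcal{A}}E_{a,b}: b\in\mathcal{A}\}$, $$\lim_{d\to1^+}P^{(\infty)}(d,E)=\log\rho(E)\quad\text{and}\quad \lim_{d\to\infty}P^{(\infty)}(d,E)=\log r_E .$$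
   Context: $\mathbb{Z}_+=\{0,1,2,\dots\}$. "Increasing" means non-decreasing. Tree-shift and pressure. For an integer $d\ge2$, the rooted $d$-tree $\mathcal{T}^{(d)}$ is the free monoid generated by $f_1,\dots,f_d$, with identity (root) $\epsilon$. Put $\Xi_n=\{f_1,\dots,f_d\}^n$ (words of length $n$) and $\Delta_n=\bigcup_{i=0}^n\Xi_i$. Let $X_E=\{x\in\mathcal{A}^{\mathbb{Z}_+}: E_{x_{n+1},x_n}>0\ \forall n\in\mathbb{Z}_+\}$ and $$X_E^{\times d}=\{x\in\mathcal{A}^{\mathcal{T}^{(d)}}: (x_{gf_i^n})_{n\in\mathbb{Z}_+}\in X_E\ \ \forall g\in\mathcal{T}^{(d)},\ 1\le i\le d\}.$$ The partition function on $\Delta_n$ is $$Z_n=\sum_{u}w_{u_\epsilon}\prod_{g\in\Delta_{n-1}}\prod_{i=1}^dE_{u_{gf_i},u_g},$$ where $u$ ranges over the set of restrictions to $\Delta_n$ of elements of $X_E^{\times d}$. The topological pressure is $\mathbf{P}(X_E^{\times d},E)=\lim_{n\to\infty}\frac{\log Z_n}{|\Delta_n|}$; this limit is known to exist and does not depend on $w$. Optimization problem. Let $\Gamma_{\mathcal{A}}$ be the set of probability vectors indexed by $\mathcal{A}$ and $\Upsilon_{\mathcal{A}}$ the set of left stochastic $\mathcal{A}\times\mathcal{A}$ matrices (non-negative entries, each column sums to $1$). For real $d>1$, $P^{(\infty)}(d,E)$ is the maximum of $$\sum_{j=0}^\infty\frac{d-1}{d^{j+1}}\sum_{a\in\mathcal{A}}\sum_{b\in\mathcal{A}}\mathsf{p}^{(j+1)}_a\,\mathsf{P}^{(j)}_{b,a}\log\frac{E_{b,a}}{\mathsf{P}^{(j)}_{b,a}}$$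 over all sequences $(\mathsf{p}^{(j)})_{j\ge0}\in\Gamma_{\mathcal{A}}^{\mathbb{Z}_+}$ and $(\mathsf{P}^{(j)})_{j\ge0}\in\Upsilon_{\mathcal{A}}^{\mathbb{Z}_+}$ such that for all $j\ge0$: $\mathsf{P}^{(j)}_{a,b}=0$ whenever $E_{a,b}=0$, and $\mathsf{p}^{(j)}=\mathsf{P}^{(j)}\mathsf{p}^{(j+1)}$. Terms with $\mathsf{P}^{(j)}_{b,a}=0$ are interpreted as $0$. The maximum is attained (the feasible set is compact and the objective continuous). *)

theory Defs
  imports "HOL-Analysis.Analysis" "Jordan_Normal_Form.Spectral_Radius"
begin

no_notation vec_index (infixl \<open>$\<close> 100)

text \<open>
  The alphabet is a finite type \<open>'a\<close>.  For a matrix \<open>M\<close>, the entry \<open>M $ a $ b\<close> has row index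
  \<open>a\<close> and column index \<open>b\<close>.
\<close>

section \<open>The tree, the tree-shift and its pressure\<close>

text \<open>
  The free monoid on \<open>f\<^sub>1, \<dots>, f\<^sub>d\<close> is the set of words over \<open>{1..d}\<close>, so that \<open>g f\<^sub>i\<close> is
  \<open>g @ [i]\<close> and \<open>g f\<^sub>i\<^sup>n\<close> is \<open>g @ replicate n i\<close>.
\<close>

definition tree :: "nat \<Rightarrow> nat list set" where
  "tree d = lists {1..d}"

definition level :: "nat \<Rightarrow> nat \<Rightarrow> nat list set" where
  "level d n = {g \<in> tree d. length g = n}"

definition Delta :: "nat \<Rightarrow> nat \<Rightarrow> nat list set" where
  "Delta d n = (\<Union>i\<le>n. level d i)"

definition shift_space :: "real ^ 'a ^ 'a \<Rightarrow> (nat \<Rightarrow> 'a::finite) set" where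
  "shift_space E = {x. \<forall>n. E $ x (n + 1) $ x n > 0}"

definition axial_product :: "nat \<Rightarrow> real ^ 'a ^ 'a \<Rightarrow> (nat list \<Rightarrow> 'a::finite) set" where
  "axial_product d E =
     {x \<in> tree d \<rightarrow>\<^sub>E UNIV.
        \<forall>g \<in> tree d. \<forall>i \<in> {1..d}. (\<lambda>n. x (g @ replicate n i)) \<in> shift_space E}"

text \<open>
  The product below ranges over the words of length less than \<open>n\<close>.  For \<open>n > 0\<close> these form
  \<open>Delta d (n - 1)\<close>; for \<open>n = 0\<close> there are none, whereas \<open>0 - 1 = 0\<close> on natural numbers.
\<close>

definition partition_function ::
    "nat \<Rightarrow> real ^ 'a \<Rightarrow> real ^ 'a ^ 'a \<Rightarrow> nat \<Rightarrow> real" where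
  "partition_function d w E n =
     (\<Sum>u \<in> (\<lambda>x. restrict x (Delta d n)) ` axial_product d (E :: real ^ 'a::finite ^ 'a).
        w $ u [] * (\<Prod>g \<in> (\<Union>k<n. level d k). \<Prod>i\<in>{1..d}. E $ u (g @ [i]) $ u g))"

definition pressure :: "nat \<Rightarrow> real ^ 'a \<Rightarrow> real ^ 'a ^ 'a::finite \<Rightarrow> real" where
  "pressure d w E = lim (\<lambda>n. ln (partition_function d w E n) / real (card (Delta d n)))"

section \<open>The optimization problem\<close>

definition prob_vectors :: "(real ^ 'a::finite) set" where
  "prob_vectors = {p. (\<forall>a. p $ a \<ge> 0) \<and> (\<Sum>a\<in>UNIV. p $ a) = 1}"

definition left_stochastic :: "(real ^ 'a ^ 'a::finite) set" where
  "left_stochastic = {P. (\<forall>a b. P $ a $ b \<ge> 0) \<and> (\<forall>b. (\<Sum>a\<in>UNIV. P $ a $ b) = 1)}"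

definition feasible ::
    "real ^ 'a ^ 'a::finite \<Rightarrow> ((nat \<Rightarrow> real ^ 'a) \<times> (nat \<Rightarrow> real ^ 'a ^ 'a)) set" where
  "feasible E =
     {(p, P). (\<forall>j. p j \<in> prob_vectors) \<and> (\<forall>j. P j \<in> left_stochastic) \<and>
        (\<forall>j a b. E $ a $ b = 0 \<longrightarrow> P j $ a $ b = 0) \<and>
        (\<forall>j. p j = P j *v p (Suc j))}"

text \<open>Terms with \<open>P j $ b $ a = 0\<close> vanish because of the factor in front of the logarithm.\<close>

definition objective ::
    "real \<Rightarrow> real ^ 'a ^ 'a::finite \<Rightarrow> (nat \<Rightarrow> real ^ 'a) \<times> (nat \<Rightarrow> real ^ 'a ^ 'a) \<Rightarrow> real" where
  "objective d E = (\<lambda>(p, P).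
     \<Sum>j. (d - 1) / d ^ (j + 1) *
       (\<Sum>a\<in>UNIV. \<Sum>b\<in>UNIV.
          p (j + 1) $ a * P j $ b $ a * ln (E $ b $ a / P j $ b $ a)))"

text \<open>The constant \<open>Max\<close> is meaningful for finite sets only; \<open>GREATEST\<close> is the maximum.\<close>

definition P_inf :: "real \<Rightarrow> real ^ 'a ^ 'a::finite \<Rightarrow> real" where
  "P_inf d E = (GREATEST v. v \<in> objective d E ` feasible E)"

section \<open>Spectral radius and maximal column sum\<close>

text \<open>
  \<open>spectral_radius\<close> applies to complex matrices indexed by initial segments of the natural
  numbers; \<open>from_nat_into UNIV\<close> is a bijection from \<open>{..<CARD('a)}\<close> onto the alphabet, and the
  spectrum does not depend on the enumeration chosen.
\<close>

definition rho :: "real ^ 'a ^ 'a::finite \<Rightarrow> real" where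
  "rho E = spectral_radius
     (mat CARD('a) CARD('a)
       (\<lambda>(i, j). complex_of_real
          (E $ from_nat_into (UNIV :: 'a set) i $ from_nat_into (UNIV :: 'a set) j)))"

definition max_column_sum :: "real ^ 'a ^ 'a::finite \<Rightarrow> real" where
  "max_column_sum E = Max (range (\<lambda>b. \<Sum>a\<in>UNIV. E $ a $ b))"

end

theory Submission
  imports Defs "HOL-Real_Asymp.Real_Asymp"
begin

text \<open>
  Put \<open>s = 1 / d\<close>. For a feasible sequence let \<open>h\<^sub>j\<close> be the expected value, under the
  distribution \<open>p\<^bsub>j+1\<^esub>\<close> of a parent, of the entropy-plus-energy gained when the child is drawn from
  the kernel \<open>P\<^sub>j\<close> (\<open>reward\<close>). The objective is the Abel mean \<open>(1 - s) \<Sum>\<^sub>j s\<^sup>j h\<^sub>j\<close>. The set of all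
  reward sequences is uniformly bounded and closed under the shift, because deleting the
  entries with index \<open>0\<close> from a feasible sequence leaves a feasible sequence. By compactness of the feasible set the
  maximum is attained, so \<open>P_inf d E\<close> is the supremum of these Abel means.

  Boundedness and shift invariance alone give most of the theorem. The supremum of Abel means is
  continuous in \<open>s\<close> because the geometric weights are Lipschitz in \<open>s\<close>. It decreases in \<open>s\<close> (thus
  increases in \<open>d\<close>) because an Abel mean with a larger \<open>s\<close> is a convex combination of Abel means,
  with a smaller \<open>s\<close>, of shifts of the same sequence. As \<open>s\<close> tends to \<open>0\<close> it tends to the supremum of
  \<open>h\<^sub>0\<close>. As \<open>s\<close> tends to \<open>1\<close> it tends to the limit of \<open>g N / N\<close>, where \<open>g N\<close> is the maximum of
  \<open>h\<^sub>0 + \<dots> + h\<^bsub>N-1\<^esub>\<close>: Abel means and uniform block averages have the same asymptotics.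

  The finite problems are solved by dynamic programming. Let \<open>L\<^sub>0 = 0\<close> and
  \<open>L\<^bsub>n+1\<^esub> a = c ln (\<Sum>\<^sub>b E\<^bsub>b,a\<^esub> exp (L\<^sub>n b))\<close> (\<open>log_partition\<close>). The Gibbs variational principle shows
  that the maximum of \<open>\<Sum>\<^bsub>j<n\<^esub> c\<^bsup>n-j\<^esup> h\<^sub>j\<close> over feasible sequences is \<open>max\<^sub>a L\<^sub>n a\<close>. The
  maximising kernels depend on \<open>j\<close> but not on the horizon \<open>n\<close>, and positivity of the row sums allows any
  finite solution to be extended to an infinite feasible sequence.

  For \<open>c = 1\<close>, \<open>exp (L\<^sub>n a)\<close> is a column sum of \<open>E\<^sup>n\<close>, so \<open>g N / N\<close> tends to \<open>ln (rho E)\<close> by Gelfand's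
  formula, and \<open>g 1\<close> is the logarithm of the largest column sum; these are the two limits in \<open>d\<close>.
  For \<open>c = d\<close> a natural number, \<open>exp (L\<^sub>n a)\<close> is the partition function of the ball of radius \<open>n\<close> with
  symbol \<open>a\<close> at the root, since the \<open>d\<close> subtrees below a vertex are independent given its symbol.
  Hence \<open>ln Z\<^sub>n\<close> is \<open>max\<^sub>a L\<^sub>n a\<close> up to a bounded error, and the truncation of the Abel mean after \<open>n\<close>
  terms is \<open>(d - 1) / d\<^bsup>n+1\<^esup>\<close> times the finite problem, which identifies the pressure with \<open>P_inf\<close>.
\<close>

section \<open>Abel means of bounded sequences\<close>

definition abel_mean :: "real \<Rightarrow> (nat \<Rightarrow> real) \<Rightarrow> real" where
  "abel_mean s h = (\<Sum>j. (1 - s) * s ^ j * h j)"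

lemma summable_abel_mean:
  fixes s :: real
  assumes "0 \<le> s" "s < 1" "\<And>j. \<bar>h j\<bar> \<le> B"
  shows "summable (\<lambda>j. (1 - s) * s ^ j * h j)"
proof (rule summable_comparison_test')
  show "summable (\<lambda>j. (1 - s) * s ^ j * B)"
    using assms by (intro summable_mult2 summable_mult summable_geometric) auto
  show "norm ((1 - s) * s ^ j * h j) \<le> (1 - s) * s ^ j * B" if "0 \<le> j" for j
    using assms by (auto simp: abs_mult intro!: mult_left_mono)
qed

lemma abel_mean_const:
  assumes "0 \<le> s" "s < 1"
  shows "abel_mean s (\<lambda>_. B) = B"
proof -
  have "(\<lambda>j. (1 - s) * s ^ j * B) sums ((1 - s) * (1 / (1 - s)) * B)"
    using assms by (intro sums_mult2 sums_mult geometric_sums) auto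
  then show ?thesis
    using assms by (simp add: abel_mean_def sums_iff)
qed

lemma abel_mean_mono:
  assumes "0 \<le> s" "s < 1" "\<And>j. \<bar>h j\<bar> \<le> B" "\<And>j. \<bar>k j\<bar> \<le> C" "\<And>j. h j \<le> k j"
  shows "abel_mean s h \<le> abel_mean s k"
  unfolding abel_mean_def
  using assms by (intro suminf_le summable_abel_mean mult_left_mono) auto

lemma abel_mean_le:
  assumes "0 \<le> s" "s < 1" "\<And>j. \<bar>h j\<bar> \<le> B" "\<And>j. h j \<le> M"
  shows "abel_mean s h \<le> M"
  using abel_mean_mono[OF assms(1,2), of h B "\<lambda>_. M" "\<bar>M\<bar>"] abel_mean_const[OF assms(1,2)] assms(3,4)
  by simp

lemma abel_mean_ge:
  assumes "0 \<le> s" "s < 1" "\<And>j. \<bar>h j\<bar> \<le> B" "\<And>j. M \<le> h j"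
  shows "M \<le> abel_mean s h"
  using abel_mean_mono[OF assms(1,2), of "\<lambda>_. M" "\<bar>M\<bar>" h B] abel_mean_const[OF assms(1,2)] assms(3,4)
  by simp

lemma abs_abel_mean_le:
  assumes "0 \<le> s" "s < 1" "\<And>j. \<bar>h j\<bar> \<le> B"
  shows "\<bar>abel_mean s h\<bar> \<le> B"
proof -
  have "h j \<le> B" "- B \<le> h j" for j
    using assms(3)[of j] by linarith+
  then show ?thesis
    using abel_mean_le[of s h B B] abel_mean_ge[of s h B "- B"] assms by (simp add: abs_le_iff)
qed

lemma abel_mean_Suc:
  assumes "0 \<le> s" "s < 1" "\<And>j. \<bar>h j\<bar> \<le> B"
  shows "abel_mean s h = (1 - s) * h 0 + s * abel_mean s (\<lambda>j. h (Suc j))"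
proof -
  have "summable (\<lambda>j. (1 - s) * s ^ j * h (Suc j))"
    using assms by (intro summable_abel_mean) auto
  then have "(\<Sum>j. (1 - s) * s ^ Suc j * h (Suc j)) = s * abel_mean s (\<lambda>j. h (Suc j))"
    unfolding abel_mean_def by (subst suminf_mult[symmetric]) (auto simp: mult_ac)
  then show ?thesis
    using suminf_split_head[OF summable_abel_mean[of s h B, OF assms]] by (simp add: abel_mean_def)
qed

lemma abel_mean_split:
  assumes "0 \<le> s" "s < 1" "\<And>j. \<bar>h j\<bar> \<le> B"
  shows "abel_mean s h = (\<Sum>j<n. (1 - s) * s ^ j * h j) + s ^ n * abel_mean s (\<lambda>j. h (n + j))"
proof (induction n)
  case (Suc n)
  have "abel_mean s (\<lambda>j. h (n + j)) = (1 - s) * h n + s * abel_mean s (\<lambda>j. h (Suc n + j))"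
    using abel_mean_Suc[of s "\<lambda>j. h (n + j)" B] assms by simp
  then have "s ^ n * abel_mean s (\<lambda>j. h (n + j))
      = s ^ n * ((1 - s) * h n + s * abel_mean s (\<lambda>j. h (Suc n + j)))" by simp
  then show ?case using Suc by (simp add: algebra_simps)
qed simp

lemma abel_mean_diff:
  assumes "0 \<le> s" "s < 1" "\<And>j. \<bar>h j\<bar> \<le> B" "\<And>j. \<bar>k j\<bar> \<le> C"
  shows "abel_mean s (\<lambda>j. h j - c * k j) = abel_mean s h - c * abel_mean s k"
proof -
  note sh = summable_abel_mean[of s h B, OF assms(1-3)]
  note sk = summable_abel_mean[of s k C, OF assms(1,2,4)]
  have "abel_mean s (\<lambda>j. h j - c * k j)
      = (\<Sum>j. (1 - s) * s ^ j * h j - c * ((1 - s) * s ^ j * k j))"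
    unfolding abel_mean_def by (simp add: algebra_simps)
  also have "\<dots> = abel_mean s h - c * abel_mean s k"
    unfolding abel_mean_def using sh sk
    by (subst suminf_diff[symmetric]) (auto simp: suminf_mult intro!: summable_mult)
  finally show ?thesis .
qed

lemma abel_mean_sum:
  assumes "0 \<le> s" "s < 1" "\<And>i j. \<bar>h i j\<bar> \<le> B"
  shows "abel_mean s (\<lambda>j. \<Sum>i<N. h i j) = (\<Sum>i<N. abel_mean s (h i))"
  unfolding abel_mean_def sum_distrib_left
  using assms by (intro suminf_sum summable_abel_mean) auto

text \<open>
  Termwise \<open>\<bar>(1 - s) s\<^sup>j - (1 - t) t\<^sup>j\<bar> \<le> (1 - s) (t\<^sup>j - s\<^sup>j) + (t - s) t\<^sup>j\<close> for \<open>s \<le> t\<close>, and both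
  parts of the right-hand side sum to \<open>(t - s) / (1 - t)\<close>.
\<close>

lemma abel_mean_lipschitz:
  assumes "0 \<le> s" "s \<le> t" "t < 1" "\<And>j. \<bar>h j\<bar> \<le> B"
  shows "\<bar>abel_mean s h - abel_mean t h\<bar> \<le> 2 * B * (t - s) / (1 - t)"
proof -
  have s: "s < 1" and t: "0 \<le> t" using assms by auto
  have B: "0 \<le> B" using assms(4)[of 0] by linarith
  let ?w = "\<lambda>j. (1 - s) * (t ^ j - s ^ j) + (t - s) * t ^ j"
  have gt: "(\<lambda>j. t ^ j) sums (1 / (1 - t))" and gs: "(\<lambda>j. s ^ j) sums (1 / (1 - s))"
    using assms s t by (auto intro!: geometric_sums)
  have w: "(\<lambda>j. ?w j * B) sums (((1 - s) * (1 / (1 - t) - 1 / (1 - s)) + (t - s) * (1 / (1 - t))) * B)"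
    by (intro sums_mult2 sums_add sums_mult sums_diff gt gs)
  have term_le: "\<bar>(1 - s) * s ^ j * h j - (1 - t) * t ^ j * h j\<bar> \<le> ?w j * B" for j
  proof -
    have pw: "0 \<le> s ^ j" "s ^ j \<le> t ^ j" "0 \<le> t ^ j"
      using assms by (auto intro!: power_mono)
    have "(1 - s) * s ^ j - (1 - t) * t ^ j = (t - s) * t ^ j - (1 - s) * (t ^ j - s ^ j)"
      by (simp add: algebra_simps)
    moreover have "0 \<le> (t - s) * t ^ j" "0 \<le> (1 - s) * (t ^ j - s ^ j)"
      using pw assms s by auto
    ultimately have "\<bar>(1 - s) * s ^ j - (1 - t) * t ^ j\<bar> \<le> ?w j" by linarith
    then have "\<bar>(1 - s) * s ^ j - (1 - t) * t ^ j\<bar> * \<bar>h j\<bar> \<le> ?w j * B"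
      using assms(4) by (intro mult_mono) auto
    then show ?thesis by (simp add: abs_mult[symmetric] algebra_simps)
  qed
  note ss = summable_abel_mean[of s h B, OF assms(1) s assms(4)]
  note st = summable_abel_mean[of t h B, OF t assms(3,4)]
  have "abel_mean s h - abel_mean t h = (\<Sum>j. (1 - s) * s ^ j * h j - (1 - t) * t ^ j * h j)"
    unfolding abel_mean_def by (rule suminf_diff[OF ss st])
  also have "\<bar>\<dots>\<bar> \<le> (\<Sum>j. ?w j * B)"
    unfolding real_norm_def[symmetric]
    by (rule norm_suminf_le) (use term_le w in \<open>auto simp: sums_iff\<close>)
  also have "\<dots> = ((1 - s) * (1 / (1 - t) - 1 / (1 - s)) + (t - s) * (1 / (1 - t))) * B"
    using w by (simp add: sums_iff)
  also have "(1 - s) * (1 / (1 - t) - 1 / (1 - s)) = (t - s) / (1 - t)"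
    using s assms(3) by (simp add: divide_simps)
  also have "((t - s) / (1 - t) + (t - s) * (1 / (1 - t))) * B = 2 * B * (t - s) / (1 - t)"
    by (simp add: add_divide_distrib[symmetric] mult_ac)
  finally show ?thesis .
qed

text \<open>
  Let \<open>A k\<close> be the Abel mean with ratio \<open>s\<close> of the sequence shifted by \<open>k\<close>. Then
  \<open>(1 - s) h\<^sub>k = A k - s A (k + 1)\<close>, and summation with the weights of ratio \<open>t\<close> gives
  \<open>(1 - s) abel_mean t h = (1 - t) A 0 + (t - s) abel_mean t (\<lambda>k. A (k + 1))\<close>. All coefficients on the
  right are nonnegative because \<open>s \<le> t\<close>, so the Abel mean of ratio \<open>t\<close> is an average of the \<open>A k\<close>.
\<close>

lemma abel_mean_decreasing:
  assumes "0 \<le> s" "s \<le> t" "t < 1" "\<And>j. \<bar>h j\<bar> \<le> B"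
    and le: "\<And>k. abel_mean s (\<lambda>j. h (k + j)) \<le> M"
  shows "abel_mean t h \<le> M"
proof -
  have s: "s < 1" and t: "0 \<le> t" using assms by auto
  define A where "A k = abel_mean s (\<lambda>j. h (k + j))" for k
  have A_bd: "\<bar>A k\<bar> \<le> B" for k
    unfolding A_def by (rule abs_abel_mean_le) (use assms s in auto)
  have A_le: "A k \<le> M" for k
    unfolding A_def by (rule le)
  have h_eq: "(1 - s) * h k = A k - s * A (Suc k)" for k
    using abel_mean_Suc[OF assms(1) s, of "\<lambda>j. h (k + j)" B] assms(4)
    by (simp add: A_def)
  have "(1 - s) * abel_mean t h = abel_mean t (\<lambda>k. 0 - (-(1 - s)) * h k)"
    using abel_mean_diff[OF t assms(3), of "\<lambda>_. 0" 0 h B "-(1 - s)"] assms(4)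
      abel_mean_const[OF t assms(3), of 0] by (simp add: algebra_simps)
  also have "\<dots> = abel_mean t (\<lambda>k. A k - s * A (Suc k))"
    by (simp add: h_eq[symmetric] algebra_simps)
  also have "\<dots> = abel_mean t A - s * abel_mean t (\<lambda>k. A (Suc k))"
    using A_bd by (intro abel_mean_diff[OF t assms(3)]) auto
  also have "\<dots> = (1 - t) * A 0 + (t - s) * abel_mean t (\<lambda>k. A (Suc k))"
    using abel_mean_Suc[of t A B, OF t assms(3) A_bd] by (simp add: algebra_simps)
  also have "\<dots> \<le> (1 - t) * M + (t - s) * M"
    using assms(2,3) A_le A_bd t by (intro add_mono mult_left_mono abel_mean_le[of _ _ B]) auto
  finally have "(1 - s) * abel_mean t h \<le> (1 - s) * M"
    by (simp add: algebra_simps)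
  then show ?thesis using s by simp
qed

text \<open>
  The relation \<open>h\<^sub>k = A k + s / (1 - s) (A k - A (k + 1))\<close>, with \<open>A k\<close> the Abel mean of the
  sequence shifted by \<open>k\<close>, telescopes: a block sum exceeds \<open>N\<close> times the largest \<open>A k\<close> by at most a
  constant that does not grow with \<open>N\<close>.
\<close>

lemma sum_le_abel_mean_bound:
  assumes "0 \<le> s" "s < 1" "\<And>j. \<bar>h j\<bar> \<le> B"
    and le: "\<And>k. abel_mean s (\<lambda>j. h (k + j)) \<le> M"
  shows "(\<Sum>j<N. h j) \<le> real N * M + 2 * B * s / (1 - s)"
proof -
  define A where "A k = abel_mean s (\<lambda>j. h (k + j))" for k
  have A_bd: "\<bar>A k\<bar> \<le> B" for k
    unfolding A_def by (rule abs_abel_mean_le) (use assms in auto)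
  have h_eq: "h k = A k + s / (1 - s) * (A k - A (Suc k))" for k
    using abel_mean_Suc[OF assms(1,2), of "\<lambda>j. h (k + j)" B] assms
    by (simp add: A_def field_simps)
  have "(\<Sum>j<N. h j) = (\<Sum>j<N. A j) + s / (1 - s) * (\<Sum>j<N. A j - A (Suc j))"
    by (subst h_eq) (simp add: sum.distrib sum_distrib_left)
  also have "(\<Sum>j<N. A j - A (Suc j)) = A 0 - A N"
    by (rule sum_lessThan_telescope')
  also have "(\<Sum>j<N. A j) + s / (1 - s) * (A 0 - A N) \<le> real N * M + s / (1 - s) * (2 * B)"
  proof (intro add_mono mult_left_mono)
    show "(\<Sum>j<N. A j) \<le> real N * M"
      using sum_bounded_above[of "{..<N}" A M] le by (simp add: A_def)
    show "A 0 - A N \<le> 2 * B" using A_bd[of 0] A_bd[of N] by linarith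
  qed (use assms in auto)
  finally show ?thesis by (simp add: mult_ac)
qed

text \<open>
  A shift by one changes an Abel mean by at most \<open>2 B (1 - s)\<close>. Averaging over the first \<open>N\<close> shifts
  replaces every term of the sequence by the sum of a block of length \<open>N\<close>.
\<close>

lemma abel_mean_le_block_bound:
  assumes "0 \<le> s" "s < 1" "\<And>j. \<bar>h j\<bar> \<le> B"
    and le: "\<And>k. (\<Sum>i<N. h (k + i)) \<le> g"
  shows "real N * abel_mean s h \<le> g + 2 * B * real N ^ 2 * (1 - s)"
proof -
  have B: "0 \<le> B" using assms(3)[of 0] by linarith
  have step: "abel_mean s (\<lambda>j. h (i + j)) - abel_mean s (\<lambda>j. h (Suc i + j)) \<le> 2 * B * (1 - s)" for i
  proof -
    let ?x = "abel_mean s (\<lambda>j. h (Suc i + j))"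
    have "\<bar>?x\<bar> \<le> B" by (rule abs_abel_mean_le) (use assms in auto)
    then have "h i - ?x \<le> 2 * B" using assms(3)[of i] by linarith
    then have "(1 - s) * (h i - ?x) \<le> (1 - s) * (2 * B)"
      using assms by (intro mult_left_mono) auto
    moreover have "abel_mean s (\<lambda>j. h (i + j)) - ?x = (1 - s) * (h i - ?x)"
      using abel_mean_Suc[OF assms(1,2), of "\<lambda>j. h (i + j)" B] assms(3)
      by (simp add: algebra_simps)
    ultimately show ?thesis by (simp add: mult_ac)
  qed
  have shift: "abel_mean s h \<le> abel_mean s (\<lambda>j. h (i + j)) + real i * (2 * B * (1 - s))" for i
  proof (induction i)
    case (Suc i)
    then show ?case using step[of i] by (simp add: algebra_simps)
  qed simp
  have "real N * abel_mean s h = (\<Sum>i<N. abel_mean s h)" by simp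
  also have "\<dots> \<le> (\<Sum>i<N. abel_mean s (\<lambda>j. h (i + j)) + real N * (2 * B * (1 - s)))"
  proof (rule sum_mono)
    fix i assume "i \<in> {..<N}"
    then have "real i * (2 * B * (1 - s)) \<le> real N * (2 * B * (1 - s))"
      using B assms by (intro mult_right_mono) auto
    then show "abel_mean s h \<le> abel_mean s (\<lambda>j. h (i + j)) + real N * (2 * B * (1 - s))"
      using shift[of i] by linarith
  qed
  also have "\<dots> = (\<Sum>i<N. abel_mean s (\<lambda>j. h (i + j))) + 2 * B * real N ^ 2 * (1 - s)"
    by (simp add: sum.distrib power2_eq_square)
  also have "(\<Sum>i<N. abel_mean s (\<lambda>j. h (i + j))) = abel_mean s (\<lambda>j. \<Sum>i<N. h (i + j))"
    using assms by (intro abel_mean_sum[symmetric]) auto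
  also have "\<dots> \<le> g"
  proof (rule abel_mean_le[of _ _ "real N * B"])
    show "\<bar>\<Sum>i<N. h (i + j)\<bar> \<le> real N * B" for j
      using sum_norm_bound[of "{..<N}" "\<lambda>i. h (i + j)" B] assms(3) by simp
  qed (use assms le in \<open>auto simp: add.commute\<close>)
  finally show ?thesis by simp
qed

section \<open>Suprema of Abel means over a shift-invariant family\<close>

locale shift_invariant_rewards =
  fixes H :: "(nat \<Rightarrow> real) set" and B :: real
  assumes bounded: "h \<in> H \<Longrightarrow> \<bar>h j\<bar> \<le> B"
    and shift: "h \<in> H \<Longrightarrow> (\<lambda>j. h (Suc j)) \<in> H"
    and nonempty: "H \<noteq> {}"
begin

definition abel_sup :: "real \<Rightarrow> real" where
  "abel_sup s = (SUP h\<in>H. abel_mean s h)"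

lemma shift_add: "h \<in> H \<Longrightarrow> (\<lambda>j. h (k + j)) \<in> H"
  by (induction k) (auto dest: shift)

lemma abel_mean_le_sup:
  assumes "0 \<le> s" "s < 1" "h \<in> H"
  shows "abel_mean s h \<le> abel_sup s"
  unfolding abel_sup_def
proof (rule cSUP_upper[OF assms(3)])
  show "bdd_above (abel_mean s ` H)"
    using assms bounded by (intro bdd_aboveI[of _ B]) (auto intro: abel_mean_le[of _ _ B] abs_le_D1)
qed

lemma abel_sup_le:
  assumes "\<And>h. h \<in> H \<Longrightarrow> abel_mean s h \<le> M"
  shows "abel_sup s \<le> M"
  unfolding abel_sup_def using assms nonempty by (intro cSUP_least) auto

lemma abel_sup_antimono:
  assumes "0 \<le> s" "s \<le> t" "t < 1"
  shows "abel_sup t \<le> abel_sup s"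
  using assms bounded shift_add
  by (intro abel_sup_le abel_mean_decreasing[OF assms(1-3)] abel_mean_le_sup) auto

lemma abel_sup_lipschitz:
  assumes "0 \<le> s" "s < 1" "0 \<le> t" "t < 1"
  shows "\<bar>abel_sup s - abel_sup t\<bar> \<le> 2 * B * \<bar>t - s\<bar> / (1 - max s t)"
proof -
  have *: "abel_sup s \<le> abel_sup t + 2 * B * \<bar>t - s\<bar> / (1 - max s t)"
    if "0 \<le> s" "s < 1" "0 \<le> t" "t < 1" for s t
  proof (rule abel_sup_le)
    fix h assume h: "h \<in> H"
    have "\<bar>abel_mean s h - abel_mean t h\<bar> \<le> 2 * B * \<bar>t - s\<bar> / (1 - max s t)"
      using abel_mean_lipschitz[of s t h B] abel_mean_lipschitz[of t s h B] that bounded[OF h]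
      by (cases "s \<le> t") (auto simp: max_def abs_minus_commute[of "abel_mean s h"])
    then show "abel_mean s h \<le> abel_sup t + 2 * B * \<bar>t - s\<bar> / (1 - max s t)"
      using abel_mean_le_sup[OF that(3,4) h] by linarith
  qed
  show ?thesis
    using *[OF assms] *[OF assms(3,4,1,2), unfolded abs_minus_commute[of s t] max.commute[of t s]]
    by linarith
qed

lemma continuous_on_abel_sup: "continuous_on {0..<1} abel_sup"
  unfolding continuous_on_def
proof
  fix s :: real assume s: "s \<in> {0..<1}"
  have "((\<lambda>t. abel_sup t - abel_sup s) \<longlongrightarrow> 0) (at s within {0..<1})"
  proof (rule Lim_null_comparison)
    show "\<forall>\<^sub>F t in at s within {0..<1}. norm (abel_sup t - abel_sup s) \<le> 2 * B * \<bar>s - t\<bar> / (1 - max t s)"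
      using s by (auto simp: eventually_at_filter intro!: always_eventually abel_sup_lipschitz)
    have "((\<lambda>t. 2 * B * \<bar>s - t\<bar> / (1 - max t s)) \<longlongrightarrow> 2 * B * \<bar>s - s\<bar> / (1 - max s s)) (at s within {0..<1})"
      using s by (intro tendsto_intros) auto
    then show "((\<lambda>t. 2 * B * \<bar>s - t\<bar> / (1 - max t s)) \<longlongrightarrow> 0) (at s within {0..<1})" by simp
  qed
  then show "(abel_sup \<longlongrightarrow> abel_sup s) (at s within {0..<1})"
    by (simp add: LIM_zero_iff)
qed

text \<open>
  A Tauberian statement for the whole family: the supremum at \<open>s\<close> is bounded below by the growth rate
  of the optimal block sums for every \<open>s\<close>, and for each fixed block length \<open>N\<close> it is bounded above by
  \<open>g N / N\<close> up to an error of order \<open>1 - s\<close>.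
\<close>

lemma abel_sup_tendsto_left_1:
  assumes upper: "\<And>N h. h \<in> H \<Longrightarrow> (\<Sum>j<N. h j) \<le> g N"
    and attained: "\<And>N. \<exists>h\<in>H. (\<Sum>j<N. h j) = g N"
    and growth: "(\<lambda>N. g N / real N) \<longlonglongrightarrow> \<gamma>"
  shows "(abel_sup \<longlongrightarrow> \<gamma>) (at_left 1)"
proof (rule order_tendstoI)
  have lower: "\<gamma> \<le> abel_sup s" if s: "0 \<le> s" "s < 1" for s
  proof (rule LIMSEQ_le[OF growth])
    show "(\<lambda>N. abel_sup s + (2 * B * s / (1 - s)) / real N) \<longlonglongrightarrow> abel_sup s"
      using tendsto_add[OF tendsto_const lim_const_over_n[of "2 * B * s / (1 - s)"]] by simp
    have "g N / real N \<le> abel_sup s + (2 * B * s / (1 - s)) / real N" if "N \<ge> 1" for N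
    proof -
      obtain h where h: "h \<in> H" "(\<Sum>j<N. h j) = g N" using attained by blast
      have "g N \<le> real N * abel_sup s + 2 * B * s / (1 - s)"
        unfolding h(2)[symmetric] using s h bounded shift_add
        by (intro sum_le_abel_mean_bound abel_mean_le_sup) auto
      then have "g N / real N \<le> (real N * abel_sup s + 2 * B * s / (1 - s)) / real N"
        by (intro divide_right_mono) auto
      then show ?thesis using that by (simp add: add_divide_distrib)
    qed
    then show "\<exists>M. \<forall>N\<ge>M. g N / real N \<le> abel_sup s + (2 * B * s / (1 - s)) / real N" by blast
  qed
  fix a assume a: "a < \<gamma>"
  show "\<forall>\<^sub>F s in at_left 1. a < abel_sup s"
  proof (rule eventually_mono)
    show "\<forall>\<^sub>F s in at_left 1. s \<in> {0<..<1::real}"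
      by (rule eventually_at_left_real) simp
    show "a < abel_sup s" if "s \<in> {0<..<1}" for s
      using lower[of s] a that by auto
  qed
next
  fix a assume a: "\<gamma> < a"
  have "\<forall>\<^sub>F N in sequentially. g N / real N < a \<and> N \<ge> 1"
    using order_tendstoD(2)[OF growth a] eventually_ge_at_top by (rule eventually_conj)
  then obtain N where N: "g N / real N < a" "N \<ge> 1"
    using eventually_happens by force
  have upper': "abel_sup s \<le> g N / real N + 2 * B * real N * (1 - s)" if s: "0 \<le> s" "s < 1" for s
  proof (rule abel_sup_le)
    fix h assume h: "h \<in> H"
    have "real N * abel_mean s h \<le> g N + 2 * B * real N ^ 2 * (1 - s)"
      using s h bounded upper[OF shift_add] by (intro abel_mean_le_block_bound) auto
    then show "abel_mean s h \<le> g N / real N + 2 * B * real N * (1 - s)"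
      using N by (simp add: field_simps power2_eq_square)
  qed
  have "((\<lambda>s. g N / real N + 2 * B * real N * (1 - s)) \<longlongrightarrow> g N / real N + 2 * B * real N * (1 - 1)) (at_left 1)"
    by (intro tendsto_intros)
  then have "\<forall>\<^sub>F s in at_left 1. g N / real N + 2 * B * real N * (1 - s) < a"
    using N(1) by (intro order_tendstoD(2)) auto
  moreover have "\<forall>\<^sub>F s in at_left 1. s \<in> {0<..<1::real}"
    by (rule eventually_at_left_real) simp
  ultimately show "\<forall>\<^sub>F s in at_left 1. abel_sup s < a"
  proof eventually_elim
    case (elim s)
    then show ?case using upper'[of s] by auto
  qed
qed

text \<open>
  As \<open>s\<close> tends to \<open>0\<close> all weight concentrates on the first term, and shift invariance makes the bound
  on the first term a bound on all terms.
\<close>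

lemma abel_sup_tendsto_right_0:
  assumes "\<And>h. h \<in> H \<Longrightarrow> h 0 \<le> m" and "\<exists>h\<in>H. h 0 = m"
  shows "(abel_sup \<longlongrightarrow> m) (at_right 0)"
proof (rule tendsto_sandwich)
  obtain h where h: "h \<in> H" "h 0 = m" using assms by blast
  have all: "h j \<le> m" if "h \<in> H" for h j
    using assms(1)[OF shift_add[OF that, of j]] by simp
  have ev: "\<forall>\<^sub>F s in at_right 0. s \<in> {0<..<1::real}"
    by (rule eventually_at_right_real) simp
  then show "\<forall>\<^sub>F s in at_right 0. abel_sup s \<le> m"
    by eventually_elim (rule abel_sup_le, rule abel_mean_le[of _ _ B], auto intro: bounded all)
  show "\<forall>\<^sub>F s in at_right 0. (1 - s) * m - s * B \<le> abel_sup s"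
    using ev
  proof eventually_elim
    case (elim s)
    then have s: "0 \<le> s" "s < 1" by auto
    have "\<bar>abel_mean s (\<lambda>j. h (Suc j))\<bar> \<le> B"
      using s bounded[OF h(1)] by (intro abs_abel_mean_le) auto
    then have "s * (- B) \<le> s * abel_mean s (\<lambda>j. h (Suc j))"
      using s by (intro mult_left_mono) auto
    then have "(1 - s) * m - s * B \<le> abel_mean s h"
      using abel_mean_Suc[of s h B, OF s bounded[OF h(1)]] h(2) by simp
    then show ?case using abel_mean_le_sup[OF s h(1)] by linarith
  qed
  have "((\<lambda>s. (1 - s) * m - s * B) \<longlongrightarrow> (1 - 0) * m - 0 * B) (at_right 0)"
    by (intro tendsto_intros)
  then show "((\<lambda>s. (1 - s) * m - s * B) \<longlongrightarrow> m) (at_right 0)" by simp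
qed (rule tendsto_const)

end

section \<open>The Gibbs variational principle\<close>

text \<open>
  Apply \<open>ln t \<le> t - 1\<close> to \<open>t = e\<^sub>b exp x\<^sub>b / (q\<^sub>b S)\<close>, where \<open>S\<close> is the sum under the logarithm, and
  average over \<open>q\<close>: the bound sums to \<open>1 - 1\<close>.
\<close>

lemma gibbs_inequality:
  fixes q e x :: "'a::finite \<Rightarrow> real"
  assumes q: "\<And>b. 0 \<le> q b" "(\<Sum>b\<in>UNIV. q b) = 1"
    and e: "\<And>b. 0 \<le> e b" "\<And>b. e b = 0 \<Longrightarrow> q b = 0"
  shows "(\<Sum>b\<in>UNIV. q b * (ln (e b / q b) + x b)) \<le> ln (\<Sum>b\<in>UNIV. e b * exp (x b))"
proof -
  define S where "S = (\<Sum>b\<in>UNIV. e b * exp (x b))"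
  obtain b0 where "q b0 \<noteq> 0" using q(2) by (metis sum.neutral zero_neq_one)
  then have "0 < e b0 * exp (x b0)" using e by (metis exp_gt_zero less_eq_real_def mult_pos_pos)
  also have "\<dots> \<le> S"
    unfolding S_def by (rule member_le_sum) (use e in auto)
  finally have S: "0 < S" .
  have "q b * (ln (e b / q b) + x b - ln S) \<le> e b * exp (x b) / S - q b" for b
  proof (cases "q b = 0")
    case True
    then show ?thesis using e(1)[of b] S by simp
  next
    case False
    then have pos: "0 < q b" "0 < e b" using q(1)[of b] e(1)[of b] e(2)[of b] by force+
    then have "ln (e b / q b) + x b - ln S = ln (e b * exp (x b) / (q b * S))"
      using S by (simp add: ln_div ln_mult)
    also have "\<dots> \<le> e b * exp (x b) / (q b * S) - 1"
      using pos S by (intro ln_le_minus_one) simp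
    finally have "q b * (ln (e b / q b) + x b - ln S) \<le> q b * (e b * exp (x b) / (q b * S) - 1)"
      using pos by (intro mult_left_mono) auto
    also have "\<dots> = e b * exp (x b) / S - q b"
      using pos S by (simp add: field_simps)
    finally show ?thesis .
  qed
  then have "(\<Sum>b\<in>UNIV. q b * (ln (e b / q b) + x b - ln S)) \<le> (\<Sum>b\<in>UNIV. e b * exp (x b) / S - q b)"
    by (rule sum_mono)
  also have "\<dots> = 0"
    using S q(2) by (simp add: sum_subtractf sum_divide_distrib[symmetric] S_def[symmetric])
  also have "(\<Sum>b\<in>UNIV. q b * (ln (e b / q b) + x b - ln S))
      = (\<Sum>b\<in>UNIV. q b * (ln (e b / q b) + x b)) - ln S"
    using q(2) by (simp add: right_diff_distrib sum_subtractf sum_distrib_right[symmetric])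
  finally show ?thesis by (simp add: S_def)
qed

lemma gibbs_equality:
  fixes e x :: "'a::finite \<Rightarrow> real"
  assumes e: "\<And>b. 0 \<le> e b" and S: "S = (\<Sum>b\<in>UNIV. e b * exp (x b))" "0 < S"
    and q: "\<And>b. q b = e b * exp (x b) / S"
  shows "(\<Sum>b\<in>UNIV. q b * (ln (e b / q b) + x b)) = ln S"
proof -
  have "q b * (ln (e b / q b) + x b) = q b * ln S" for b
  proof (cases "e b = 0")
    case False
    then have "0 < e b" using e[of b] by simp
    then have "e b / q b = S / exp (x b)" using S(2) by (simp add: q field_simps)
    then show ?thesis using S(2) by (simp add: ln_div)
  qed (simp add: q)
  then have "(\<Sum>b\<in>UNIV. q b * (ln (e b / q b) + x b)) = (\<Sum>b\<in>UNIV. q b) * ln S"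
    unfolding sum_distrib_right by (rule sum.cong[OF refl])
  also have "(\<Sum>b\<in>UNIV. q b) = 1"
    using S by (simp add: q sum_divide_distrib[symmetric])
  finally show ?thesis by simp
qed

section \<open>Feasible sequences and their rewards\<close>

text \<open>
  The relative entropy of a column of \<open>P\<close> with respect to the same column of \<open>E\<close>, with the sign that
  makes it a quantity to be maximised.
\<close>

definition gain :: "real ^ 'a ^ 'a::finite \<Rightarrow> real ^ 'a ^ 'a \<Rightarrow> 'a \<Rightarrow> real" where
  "gain E P a = (\<Sum>b\<in>UNIV. P $ b $ a * ln (E $ b $ a / P $ b $ a))"

definition reward ::
    "real ^ 'a ^ 'a::finite \<Rightarrow> (nat \<Rightarrow> real ^ 'a) \<times> (nat \<Rightarrow> real ^ 'a ^ 'a) \<Rightarrow> nat \<Rightarrow> real" where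
  "reward E x j = (\<Sum>a\<in>UNIV. fst x (Suc j) $ a * gain E (snd x j) a)"

definition kernels :: "real ^ 'a ^ 'a::finite \<Rightarrow> (real ^ 'a ^ 'a) set" where
  "kernels E = {P \<in> left_stochastic. \<forall>a b. E $ a $ b = 0 \<longrightarrow> P $ a $ b = 0}"

lemma objective_eq_abel_mean:
  assumes "d > 0"
  shows "objective d E x = abel_mean (1 / d) (reward E x)"
proof -
  obtain p P where x: "x = (p, P)" by force
  have weight: "(d - 1) / d ^ (j + 1) = (1 - 1 / d) * (1 / d) ^ j" for j
    using assms by (simp add: divide_simps)
  show ?thesis
    unfolding objective_def abel_mean_def reward_def gain_def x weight
    by (simp add: sum_distrib_left mult.assoc)
qed

lemma feasible_iff:
  "x \<in> feasible E \<longleftrightarrow> (\<forall>j. fst x j \<in> prob_vectors) \<and> (\<forall>j. snd x j \<in> kernels E)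
     \<and> (\<forall>j. fst x j = snd x j *v fst x (Suc j))"
  unfolding feasible_def kernels_def by (cases x) (simp only: mem_Collect_eq prod.case fst_conv snd_conv, blast)

lemma prob_vectorsD:
  assumes "p \<in> prob_vectors"
  shows "0 \<le> p $ a" and "(\<Sum>a\<in>UNIV. p $ a) = 1" and "p $ a \<le> 1"
proof -
  show nonneg: "0 \<le> p $ a" and sum: "(\<Sum>a\<in>UNIV. p $ a) = 1" for a
    using assms unfolding prob_vectors_def by blast+
  show "p $ a \<le> 1"
    unfolding sum[symmetric] by (rule member_le_sum) (auto intro: nonneg)
qed

lemma left_stochasticD:
  assumes "P \<in> left_stochastic"
  shows "0 \<le> P $ a $ b" and "(\<Sum>a\<in>UNIV. P $ a $ b) = 1" and "P $ a $ b \<le> 1"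
proof -
  show nonneg: "0 \<le> P $ a $ b" and sum: "(\<Sum>a\<in>UNIV. P $ a $ b) = 1" for a
    using assms unfolding left_stochastic_def by blast+
  show "P $ a $ b \<le> 1"
    unfolding sum[symmetric] by (rule member_le_sum) (auto intro: nonneg)
qed

lemma kernelsD:
  assumes "P \<in> kernels E"
  shows "P \<in> left_stochastic" and "E $ a $ b = 0 \<Longrightarrow> P $ a $ b = 0"
  using assms unfolding kernels_def by blast+

lemma prob_vector_average_le:
  assumes "p \<in> prob_vectors" "\<And>a. f a \<le> m"
  shows "(\<Sum>a\<in>UNIV. p $ a * f a) \<le> m"
proof -
  have "(\<Sum>a\<in>UNIV. p $ a * f a) \<le> (\<Sum>a\<in>UNIV. p $ a * m)"
    using assms(2) by (intro sum_mono mult_left_mono prob_vectorsD(1)[OF assms(1)])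
  also have "\<dots> = m"
    unfolding sum_distrib_right[symmetric] prob_vectorsD(2)[OF assms(1)] by simp
  finally show ?thesis .
qed

lemma matrix_vector_mult_prob_vectors:
  assumes P: "P \<in> left_stochastic" and p: "p \<in> prob_vectors"
  shows "P *v p \<in> prob_vectors"
proof -
  have "(\<Sum>a\<in>UNIV. (P *v p) $ a) = (\<Sum>b\<in>UNIV. (\<Sum>a\<in>UNIV. P $ a $ b) * p $ b)"
    unfolding matrix_vector_mult_def vec_lambda_beta sum_distrib_right by (rule sum.swap)
  also have "\<dots> = 1"
    unfolding left_stochasticD(2)[OF P] mult_1_left by (rule prob_vectorsD(2)[OF p])
  finally have "(\<Sum>a\<in>UNIV. (P *v p) $ a) = 1" .
  moreover have "0 \<le> (P *v p) $ a" for a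
    unfolding matrix_vector_mult_def vec_lambda_beta
    by (intro sum_nonneg mult_nonneg_nonneg left_stochasticD(1)[OF P] prob_vectorsD(1)[OF p])
  ultimately show ?thesis unfolding prob_vectors_def by blast
qed

lemma axis_prob_vectors: "axis a 1 \<in> prob_vectors"
  by (auto simp: prob_vectors_def axis_def)

lemma feasibleD:
  assumes "x \<in> feasible E"
  shows "fst x j \<in> prob_vectors" and "snd x j \<in> kernels E"
    and "fst x j = snd x j *v fst x (Suc j)"
  using assms unfolding feasible_iff by blast+

lemma feasible_shift:
  assumes "x \<in> feasible E"
  shows "(\<lambda>j. fst x (Suc j), \<lambda>j. snd x (Suc j)) \<in> feasible E"
  unfolding feasible_iff fst_conv snd_conv
  using assms by (intro conjI allI feasibleD)

text \<open>
  Sequences run backwards in time: index \<open>0\<close> is the last generation, and a new last generation may be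
  drawn from any admissible kernel.
\<close>

lemma feasible_cons:
  assumes "x \<in> feasible E" "Q \<in> kernels E"
  shows "(case_nat (Q *v fst x 0) (fst x), case_nat Q (snd x)) \<in> feasible E"
proof -
  have "Q *v fst x 0 \<in> prob_vectors"
    using assms by (intro matrix_vector_mult_prob_vectors feasibleD) (auto simp: kernels_def)
  then show ?thesis
    unfolding feasible_iff fst_conv snd_conv
    using assms(2) feasibleD(1,2)[OF assms(1)]
    by (intro conjI allI; case_tac j) (auto intro: feasibleD(3)[OF assms(1)])
qed

lemma matrix_vector_mult_axis: "P *v axis a (1 :: real) = (\<chi> b. P $ b $ a)"
  by (simp add: Finite_Cartesian_Product.vec_eq_iff matrix_vector_mult_def axis_def mult_delta_right)

lemma compact_sequences:
  fixes S :: "('b :: topological_space) set"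
  assumes "compact S"
  shows "compact {f :: nat \<Rightarrow> 'b. \<forall>j. f j \<in> S}"
proof -
  have "compactin (product_topology (\<lambda>_::nat. euclidean) UNIV) (PiE UNIV (\<lambda>_. S))"
    unfolding compactin_PiE using assms by simp
  moreover have "PiE UNIV (\<lambda>_. S) = {f :: nat \<Rightarrow> 'b. \<forall>j. f j \<in> S}"
    by auto
  ultimately show ?thesis by (simp add: euclidean_product_topology)
qed

lemma compact_prob_vectors: "compact prob_vectors"
  unfolding compact_eq_bounded_closed
proof
  have "(prob_vectors :: (real ^ 'a) set) \<subseteq> cbox 0 (\<chi> a. 1)"
    by (auto simp: mem_box_cart dest: prob_vectorsD)
  then show "bounded (prob_vectors :: (real ^ 'a) set)"
    using bounded_cbox bounded_subset by blast
  show "closed (prob_vectors :: (real ^ 'a) set)"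
    unfolding prob_vectors_def
    by (intro closed_Collect_conj closed_Collect_all closed_Collect_le closed_Collect_eq
        continuous_intros)
qed

lemma compact_left_stochastic: "compact left_stochastic"
  unfolding compact_eq_bounded_closed
proof
  have "norm P \<le> (\<Sum>a\<in>(UNIV :: 'a set). \<Sum>b\<in>(UNIV :: 'a set). 1)" if P: "P \<in> left_stochastic" for P :: "real ^ 'a ^ 'a"
  proof -
    have le: "\<bar>P $ a $ b\<bar> \<le> 1" for a b
      using left_stochasticD(1,3)[OF P, of a b] by simp
    have "norm P \<le> (\<Sum>a\<in>UNIV. norm (P $ a))"
      unfolding norm_vec_def[of P] by (rule L2_set_le_sum) (rule norm_ge_zero)
    also have "\<dots> \<le> (\<Sum>a\<in>(UNIV :: 'a set). \<Sum>b\<in>(UNIV :: 'a set). 1)"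
      by (rule sum_mono, rule order_trans[OF norm_le_l1_cart], rule sum_mono, rule le)
    finally show ?thesis .
  qed
  then show "bounded (left_stochastic :: (real ^ 'a ^ 'a) set)"
    unfolding bounded_iff by blast
  have entry: "continuous_on UNIV (\<lambda>P :: real ^ 'a ^ 'a. P $ a $ b)" for a b
    by (intro continuous_on_component continuous_on_id)
  show "closed (left_stochastic :: (real ^ 'a ^ 'a) set)"
    unfolding left_stochastic_def
    by (intro closed_Collect_conj closed_Collect_all closed_Collect_le closed_Collect_eq
        continuous_on_const continuous_on_sum entry)
qed

lemma continuous_on_fst_coordinate: "continuous_on S (\<lambda>x. fst x (j :: nat) $ a)"
  for S :: "((nat \<Rightarrow> real ^ 'a) \<times> 'c :: topological_space) set"
  by (rule continuous_on_component[OF continuous_on_product_then_coordinatewise[OF continuous_on_fst[OF continuous_on_id]]])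

lemma continuous_on_snd_coordinate: "continuous_on S (\<lambda>x. snd x (j :: nat) $ a $ b)"
  for S :: "('c :: topological_space \<times> (nat \<Rightarrow> real ^ 'a ^ 'b)) set"
  by (intro continuous_on_component)
    (rule continuous_on_product_then_coordinatewise[OF continuous_on_snd[OF continuous_on_id]])

text \<open>
  All constraints are closed conditions on finitely many coordinates, and the coordinates range over
  compact sets, so Tychonoff's theorem applies in the product topology.
\<close>

lemma compact_feasible:
  fixes E :: "real ^ 'a ^ 'a::finite"
  shows "compact (feasible E)"
proof -
  let ?K = "{p. \<forall>j::nat. p j \<in> prob_vectors} \<times> {P. \<forall>j::nat. P j \<in> left_stochastic}"
  let ?C = "{x :: (nat \<Rightarrow> real ^ 'a) \<times> (nat \<Rightarrow> real ^ 'a ^ 'a). (\<forall>(j :: nat) a b. E $ a $ b = 0 \<longrightarrow> snd x j $ a $ b = 0) \<and>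
      (\<forall>(j :: nat) b. fst x j $ b = (\<Sum>a\<in>UNIV. snd x j $ b $ a * fst x (Suc j) $ a))}"
  have "compact ?K"
    by (intro compact_Times compact_sequences compact_prob_vectors compact_left_stochastic)
  moreover have "closed ?C"
    by (intro closed_Collect_conj closed_Collect_all closed_Collect_imp closed_Collect_eq
        open_Collect_const continuous_on_const continuous_on_sum continuous_on_mult
        continuous_on_fst_coordinate continuous_on_snd_coordinate)
  ultimately have "compact (?K \<inter> ?C)" by (rule compact_Int_closed)
  moreover have "feasible E = ?K \<inter> ?C"
  proof (rule Set.set_eqI)
    show "x \<in> feasible E \<longleftrightarrow> x \<in> ?K \<inter> ?C" for x
      unfolding feasible_iff kernels_def Finite_Cartesian_Product.vec_eq_iff matrix_vector_mult_def vec_lambda_beta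
        Int_iff mem_Times_iff mem_Collect_eq
      by blast
  qed
  ultimately show ?thesis by (rule ssubst[rotated])
qed

text \<open>
  Continuity at \<open>0\<close> is the limit \<open>x ln x \<longlongrightarrow> 0\<close>; for \<open>e = 0\<close> the term vanishes identically, as
  \<open>ln 0 = 0\<close>.
\<close>

lemma continuous_on_entropy_term:
  fixes e :: real
  assumes "0 \<le> e"
  shows "continuous_on {0..} (\<lambda>x. x * ln (e / x))"
proof (cases "e = 0")
  case False
  then have e: "0 < e" using assms by simp
  show ?thesis
    unfolding continuous_on_def
  proof
    fix x :: real assume x: "x \<in> {0..}"
    show "((\<lambda>x. x * ln (e / x)) \<longlongrightarrow> x * ln (e / x)) (at x within {0..})"
    proof (cases "x = 0")
      case True
      have "((\<lambda>x. x * ln (e / x)) \<longlongrightarrow> 0) (at_right 0)"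
        using e by real_asymp
      then show ?thesis using True by (simp add: at_within_Ici_at_right)
    next
      case False
      then show ?thesis using e x by (intro tendsto_intros) auto
    qed
  qed
qed simp

section \<open>Dynamic programming\<close>

text \<open>
  For a natural number \<open>c = d\<close> this is the logarithm of the partition function of a \<open>d\<close>-ary tree of
  height \<open>n\<close> with prescribed root symbol, without the weight \<open>w\<close> of the root.
\<close>

fun log_partition :: "real ^ 'a ^ 'a::finite \<Rightarrow> real \<Rightarrow> nat \<Rightarrow> 'a \<Rightarrow> real" where
  "log_partition E c 0 a = 0"
| "log_partition E c (Suc n) a = c * ln (\<Sum>b\<in>UNIV. E $ b $ a * exp (log_partition E c n b))"

text \<open>
  The maximiser in the variational principle with potential \<open>L\<^sub>n\<close>.
\<close>

definition gibbs_kernel :: "real ^ 'a ^ 'a::finite \<Rightarrow> real \<Rightarrow> nat \<Rightarrow> real ^ 'a ^ 'a" where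
  "gibbs_kernel E c n = (\<chi> b a. E $ b $ a * exp (log_partition E c n b) /
     (\<Sum>b'\<in>UNIV. E $ b' $ a * exp (log_partition E c n b')))"

lemma weighted_reward_Suc:
  fixes c :: real
  shows "(\<Sum>j<Suc n. c ^ (Suc n - j) * h j) = c * ((\<Sum>j<n. c ^ (n - j) * h j) + h n)"
proof -
  have "(\<Sum>j<n. c ^ (Suc n - j) * h j) = c * (\<Sum>j<n. c ^ (n - j) * h j)"
    unfolding sum_distrib_left by (rule sum.cong) (auto simp: Suc_diff_le)
  then show ?thesis by (simp add: algebra_simps)
qed

locale interaction_matrix =
  fixes E :: "real ^ 'a ^ 'a::finite"
  assumes E_nonneg: "0 \<le> E $ a $ b"
    and col_pos: "0 < (\<Sum>a\<in>UNIV. E $ a $ b)"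
    and row_pos: "0 < (\<Sum>b\<in>UNIV. E $ a $ b)"
begin

lemma ex_successor: "\<exists>b. 0 < E $ b $ a"
  using col_pos[of a] E_nonneg by (metis (mono_tags, lifting) less_irrefl less_eq_real_def sum.neutral)

lemma ex_predecessor: "\<exists>b. 0 < E $ a $ b"
  using row_pos[of a] E_nonneg by (metis (mono_tags, lifting) less_irrefl less_eq_real_def sum.neutral)

lemma weighted_column_pos:
  assumes "\<And>b. 0 < f b"
  shows "0 < (\<Sum>b\<in>UNIV. E $ b $ a * f b)"
proof -
  obtain b where "0 < E $ b $ a" using ex_successor by blast
  then show ?thesis
    using assms E_nonneg by (intro sum_pos2[of UNIV b]) (auto simp: less_imp_le)
qed

lemma gibbs_kernel_in_kernels: "gibbs_kernel E c n \<in> kernels E"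
  using weighted_column_pos[of "\<lambda>b. exp (log_partition E c n b)"] E_nonneg
  by (auto simp: kernels_def left_stochastic_def gibbs_kernel_def sum_divide_distrib[symmetric]
      less_imp_le less_imp_neq[symmetric])

lemma gain_add_potential_le:
  assumes "P \<in> kernels E"
  shows "gain E P a + (\<Sum>b\<in>UNIV. P $ b $ a * f b) \<le> ln (\<Sum>b\<in>UNIV. E $ b $ a * exp (f b))"
proof -
  have "(\<Sum>b\<in>UNIV. P $ b $ a * (ln (E $ b $ a / P $ b $ a) + f b)) \<le> ln (\<Sum>b\<in>UNIV. E $ b $ a * exp (f b))"
    by (rule gibbs_inequality)
      (use E_nonneg kernelsD[OF assms] left_stochasticD[OF kernelsD(1)[OF assms]] in blast)+
  then show ?thesis
    unfolding gain_def distrib_left sum.distrib .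
qed

lemma gain_gibbs_kernel:
  "gain E (gibbs_kernel E c n) a + (\<Sum>b\<in>UNIV. gibbs_kernel E c n $ b $ a * log_partition E c n b)
     = ln (\<Sum>b\<in>UNIV. E $ b $ a * exp (log_partition E c n b))"
  using gibbs_equality[of "\<lambda>b. E $ b $ a" _ "log_partition E c n" "\<lambda>b. gibbs_kernel E c n $ b $ a",
      OF E_nonneg refl weighted_column_pos]
  by (simp add: gain_def gibbs_kernel_def algebra_simps sum.distrib)

text \<open>
  An upper bound for gains comes from the column sums, by the variational principle without
  potential; a lower bound comes from discarding the entropy, leaving an average of \<open>ln (E $ b $ a)\<close>.
\<close>

definition reward_bound :: real where
  "reward_bound = (\<Sum>a\<in>UNIV. \<bar>ln (\<Sum>b\<in>UNIV. E $ b $ a)\<bar>) + (\<Sum>a\<in>UNIV. \<Sum>b\<in>UNIV. \<bar>ln (E $ b $ a)\<bar>)"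

lemma gain_le: "P \<in> kernels E \<Longrightarrow> gain E P a \<le> ln (\<Sum>b\<in>UNIV. E $ b $ a)"
  using gain_add_potential_le[of P a "\<lambda>_. 0"] by simp

lemma abs_gain_le:
  assumes P: "P \<in> kernels E"
  shows "\<bar>gain E P a\<bar> \<le> reward_bound"
proof -
  have "- \<bar>ln (E $ b $ a)\<bar> \<le> P $ b $ a * ln (E $ b $ a / P $ b $ a)" for b
  proof (cases "P $ b $ a = 0")
    case False
    have P01: "0 \<le> P $ b $ a" "P $ b $ a \<le> 1"
      using left_stochasticD[OF kernelsD(1)[OF P]] by blast+
    with False have pos: "0 < P $ b $ a" by simp
    moreover have "E $ b $ a \<noteq> 0" using kernelsD(2)[OF P] False by blast
    ultimately have E: "0 < E $ b $ a" using E_nonneg[of b a] by simp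
    have "- \<bar>ln (E $ b $ a)\<bar> \<le> P $ b $ a * (- \<bar>ln (E $ b $ a)\<bar>)"
      using P01 by (simp add: mult_left_le_one_le)
    also have "\<dots> \<le> P $ b $ a * ln (E $ b $ a / P $ b $ a)"
    proof (rule mult_left_mono)
      have "ln (P $ b $ a) \<le> 0" using pos P01 by simp
      moreover have "ln (E $ b $ a / P $ b $ a) = ln (E $ b $ a) - ln (P $ b $ a)"
        using E pos by (simp add: ln_div)
      ultimately show "- \<bar>ln (E $ b $ a)\<bar> \<le> ln (E $ b $ a / P $ b $ a)" by linarith
    qed (rule P01)
    finally show ?thesis .
  qed simp
  then have "(\<Sum>b\<in>UNIV. - \<bar>ln (E $ b $ a)\<bar>) \<le> gain E P a"
    unfolding gain_def by (rule sum_mono)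
  moreover have "(\<Sum>b\<in>UNIV. \<bar>ln (E $ b $ a)\<bar>) \<le> (\<Sum>a\<in>UNIV. \<Sum>b\<in>UNIV. \<bar>ln (E $ b $ a)\<bar>)"
    by (rule member_le_sum[of a UNIV "\<lambda>a. \<Sum>b\<in>UNIV. \<bar>ln (E $ b $ a)\<bar>"]) (auto intro: sum_nonneg)
  moreover have "\<bar>ln (\<Sum>b\<in>UNIV. E $ b $ a)\<bar> \<le> (\<Sum>a\<in>UNIV. \<bar>ln (\<Sum>b\<in>UNIV. E $ b $ a)\<bar>)"
    by (rule member_le_sum[of a UNIV "\<lambda>a. \<bar>ln (\<Sum>b\<in>UNIV. E $ b $ a)\<bar>"]) auto
  moreover have "0 \<le> (\<Sum>a\<in>UNIV. \<bar>ln (\<Sum>b\<in>UNIV. E $ b $ a)\<bar>)"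
    "0 \<le> (\<Sum>a\<in>UNIV. \<Sum>b\<in>UNIV. \<bar>ln (E $ b $ a)\<bar>)"
    by (auto intro!: sum_nonneg)
  ultimately show ?thesis
    using gain_le[OF P, of a] unfolding reward_bound_def sum_negf by linarith
qed

lemma abs_reward_le:
  assumes x: "x \<in> feasible E"
  shows "\<bar>reward E x j\<bar> \<le> reward_bound"
proof -
  have p: "fst x (Suc j) \<in> prob_vectors" and P: "snd x j \<in> kernels E"
    using feasibleD[OF x] by blast+
  have "\<bar>reward E x j\<bar> \<le> (\<Sum>a\<in>UNIV. \<bar>fst x (Suc j) $ a * gain E (snd x j) a\<bar>)"
    unfolding reward_def by (rule sum_abs)
  also have "\<dots> = (\<Sum>a\<in>UNIV. fst x (Suc j) $ a * \<bar>gain E (snd x j) a\<bar>)"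
    by (simp add: abs_mult prob_vectorsD(1)[OF p])
  also have "\<dots> \<le> reward_bound"
    using p abs_gain_le[OF P] by (rule prob_vector_average_le)
  finally show ?thesis .
qed

text \<open>
  Since \<open>p\<^sub>n = P\<^sub>n p\<^bsub>n+1\<^esub>\<close>, a terminal value \<open>f\<close> collected by the child is, from the point of view of the
  parent, the conditional expectation of \<open>f\<close> under \<open>P\<^sub>n\<close>.
\<close>

lemma dynamic_programming_step:
  assumes x: "x \<in> feasible E"
  shows "(\<Sum>b\<in>UNIV. fst x n $ b * f b) + reward E x n
    = (\<Sum>a\<in>UNIV. fst x (Suc n) $ a * (gain E (snd x n) a + (\<Sum>b\<in>UNIV. snd x n $ b $ a * f b)))"
proof -
  have "fst x n $ b = (\<Sum>a\<in>UNIV. snd x n $ b $ a * fst x (Suc n) $ a)" for b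
    by (subst feasibleD(3)[OF x]) (simp add: matrix_vector_mult_def)
  then have "(\<Sum>b\<in>UNIV. fst x n $ b * f b)
      = (\<Sum>b\<in>UNIV. \<Sum>a\<in>UNIV. snd x n $ b $ a * fst x (Suc n) $ a * f b)"
    by (simp add: sum_distrib_right)
  also have "\<dots> = (\<Sum>a\<in>UNIV. fst x (Suc n) $ a * (\<Sum>b\<in>UNIV. snd x n $ b $ a * f b))"
    by (subst sum.swap) (simp add: sum_distrib_left mult_ac)
  finally show ?thesis
    by (simp add: reward_def algebra_simps sum.distrib)
qed

text \<open>
  One step of the induction replaces \<open>p\<^sub>n\<close> by \<open>P\<^sub>n p\<^bsub>n+1\<^esub>\<close> and bounds what \<open>P\<^sub>n\<close> contributes by the Gibbs
  variational principle with potential \<open>L\<^sub>n\<close>.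
\<close>

lemma weighted_reward_le:
  assumes x: "x \<in> feasible E" and c: "0 \<le> c"
  shows "(\<Sum>j<n. c ^ (n - j) * reward E x j) \<le> (\<Sum>a\<in>UNIV. fst x n $ a * log_partition E c n a)"
proof (induction n)
  case (Suc n)
  have p: "fst x (Suc n) \<in> prob_vectors" and P: "snd x n \<in> kernels E"
    using feasibleD[OF x] by blast+
  have "(\<Sum>j<Suc n. c ^ (Suc n - j) * reward E x j)
      \<le> c * ((\<Sum>a\<in>UNIV. fst x n $ a * log_partition E c n a) + reward E x n)"
    unfolding weighted_reward_Suc using Suc c by (intro mult_left_mono add_right_mono)
  also have "\<dots> = (\<Sum>a\<in>UNIV. fst x (Suc n) $ a *
      (c * (gain E (snd x n) a + (\<Sum>b\<in>UNIV. snd x n $ b $ a * log_partition E c n b))))"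
    unfolding dynamic_programming_step[OF x] by (simp add: sum_distrib_left mult_ac)
  also have "\<dots> \<le> (\<Sum>a\<in>UNIV. fst x (Suc n) $ a * log_partition E c (Suc n) a)"
    unfolding log_partition.simps
    by (intro sum_mono mult_left_mono gain_add_potential_le[OF P] prob_vectorsD(1)[OF p] c)
  finally show ?case .
qed simp

lemma weighted_reward_eq:
  assumes x: "x \<in> feasible E" and K: "\<And>j. j < n \<Longrightarrow> snd x j = gibbs_kernel E c j"
  shows "(\<Sum>j<n. c ^ (n - j) * reward E x j) = (\<Sum>a\<in>UNIV. fst x n $ a * log_partition E c n a)"
  using K
proof (induction n)
  case (Suc n)
  have "(\<Sum>j<Suc n. c ^ (Suc n - j) * reward E x j)
      = c * ((\<Sum>a\<in>UNIV. fst x n $ a * log_partition E c n a) + reward E x n)"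
    unfolding weighted_reward_Suc using Suc by simp
  also have "\<dots> = (\<Sum>a\<in>UNIV. fst x (Suc n) $ a *
      (c * (gain E (snd x n) a + (\<Sum>b\<in>UNIV. snd x n $ b $ a * log_partition E c n b))))"
    unfolding dynamic_programming_step[OF x] by (simp add: sum_distrib_left mult_ac)
  also have "\<dots> = (\<Sum>a\<in>UNIV. fst x (Suc n) $ a * log_partition E c (Suc n) a)"
    using Suc.prems gain_gibbs_kernel by simp
  finally show ?case .
qed simp

text \<open>
  The kernels below generation \<open>n\<close> may be chosen freely, provided that the generation \<open>n\<close> has an
  infinite past. Positive row sums give every symbol a predecessor, so there is a deterministic
  past: generation \<open>j\<close> sits at \<open>s j\<close>, and the column of \<open>s (j + 1)\<close> is the point mass at \<open>s j\<close>.
\<close>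

lemma ex_feasible_prefix:
  assumes "\<And>j. Q j \<in> kernels E"
  shows "\<exists>x\<in>feasible E. fst x n = axis a 1 \<and> (\<forall>j<n. snd x j = Q j)"
  using assms
proof (induction n arbitrary: Q)
  case 0
  obtain prev where prev: "0 < E $ a $ prev a" for a
    using ex_predecessor by metis
  define s where "s j = (prev ^^ j) a" for j
  have s_Suc: "s (Suc j) = prev (s j)" for j by (simp add: s_def)
  define P where "P j = (\<chi> b b'. if b' = s (Suc j) then (if b = s j then 1 else 0) else Q 0 $ b $ b')" for j
  have P_col: "P j $ b $ b' = (if b' = s (Suc j) then (if b = s j then 1 else 0) else Q 0 $ b $ b')" for j b b'
    by (simp add: P_def)
  have P_kernels: "P j \<in> kernels E" for j
    unfolding kernels_def left_stochastic_def mem_Collect_eq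
  proof (intro conjI allI impI)
    note Q0 = kernelsD[OF 0[of 0]]
    show "0 \<le> P j $ b $ b'" for b b'
      using left_stochasticD(1)[OF Q0(1)] by (simp add: P_col)
    show "(\<Sum>b\<in>UNIV. P j $ b $ b') = 1" for b'
      using left_stochasticD(2)[OF Q0(1)] by (cases "b' = s (Suc j)") (simp_all add: P_col)
    show "P j $ b $ b' = 0" if "E $ b $ b' = 0" for b b'
      using that Q0(2) prev[of "s j"] s_Suc[of j] by (auto simp: P_col)
  qed
  have P_axis: "axis (s j) 1 = P j *v axis (s (Suc j)) 1" for j
    unfolding matrix_vector_mult_axis Finite_Cartesian_Product.vec_eq_iff
    by (simp add: P_col axis_def)
  have "(\<lambda>j. axis (s j) 1, P) \<in> feasible E"
    unfolding feasible_iff fst_conv snd_conv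
    by (intro conjI allI axis_prob_vectors P_kernels) (rule P_axis)
  moreover have "fst (\<lambda>j. axis (s j) (1 :: real), P) 0 = axis a 1"
    by (simp add: s_def)
  ultimately show ?case by blast
next
  case (Suc n)
  obtain x where x: "x \<in> feasible E" "fst x n = axis a 1" "\<forall>j<n. snd x j = Q (Suc j)"
    using Suc.IH[of "\<lambda>j. Q (Suc j)"] Suc.prems by blast
  let ?y = "(case_nat (Q 0 *v fst x 0) (fst x), case_nat (Q 0) (snd x))"
  have "?y \<in> feasible E"
    by (rule feasible_cons[OF x(1) Suc.prems])
  moreover have "fst ?y (Suc n) = axis a 1"
    using x(2) by simp
  moreover have "snd ?y j = Q j" if "j < Suc n" for j
    using x(3) that by (cases j) simp_all
  ultimately show ?case by blast
qed

lemma weighted_reward_attained: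
  "\<exists>x\<in>feasible E. (\<Sum>j<n. c ^ (n - j) * reward E x j) = log_partition E c n a"
proof -
  obtain x where x: "x \<in> feasible E" "fst x n = axis a 1" "\<forall>j<n. snd x j = gibbs_kernel E c j"
    using ex_feasible_prefix[of "gibbs_kernel E c" n a, OF gibbs_kernel_in_kernels] by blast
  have "(\<Sum>j<n. c ^ (n - j) * reward E x j) = (\<Sum>b\<in>UNIV. fst x n $ b * log_partition E c n b)"
    by (rule weighted_reward_eq[OF x(1)]) (use x(3) in blast)
  also have "\<dots> = (\<Sum>b\<in>UNIV. if b = a then log_partition E c n b else 0)"
    unfolding x(2) by (intro sum.cong refl) (simp add: axis_def)
  also have "\<dots> = log_partition E c n a" by simp
  finally show ?thesis using x(1) by blast
qed

lemma weighted_reward_le_Max: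
  assumes x: "x \<in> feasible E" and c: "0 \<le> c"
  shows "(\<Sum>j<n. c ^ (n - j) * reward E x j) \<le> Max (range (log_partition E c n))"
proof -
  have "(\<Sum>a\<in>UNIV. fst x n $ a * log_partition E c n a) \<le> Max (range (log_partition E c n))"
    by (rule prob_vector_average_le[OF feasibleD(1)[OF x]]) (rule Max_ge, simp_all)
  with weighted_reward_le[OF assms] show ?thesis by (rule order_trans)
qed

lemma weighted_reward_Max_attained:
  "\<exists>x\<in>feasible E. (\<Sum>j<n. c ^ (n - j) * reward E x j) = Max (range (log_partition E c n))"
proof -
  have "Max (range (log_partition E c n)) \<in> range (log_partition E c n)"
    by (rule Max_in) simp_all
  then obtain a where "Max (range (log_partition E c n)) = log_partition E c n a" ..
  then show ?thesis using weighted_reward_attained[of c n a] by simp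
qed

section \<open>The value of the optimization problem\<close>

sublocale shift_invariant_rewards "reward E ` feasible E" reward_bound
proof
  show "\<bar>h j\<bar> \<le> reward_bound" if "h \<in> reward E ` feasible E" for h j
    using that abs_reward_le by auto
  show "(\<lambda>j. h (Suc j)) \<in> reward E ` feasible E" if h: "h \<in> reward E ` feasible E" for h
  proof -
    obtain x where x: "x \<in> feasible E" "h = reward E x" using h by blast
    have "(\<lambda>j. h (Suc j)) = reward E (\<lambda>j. fst x (Suc j), \<lambda>j. snd x (Suc j))"
      unfolding x(2) by (rule ext) (simp add: reward_def)
    then show ?thesis using feasible_shift[OF x(1)] by (rule image_eqI)
  qed
  show "reward E ` feasible E \<noteq> {}"
    using weighted_reward_attained by blast
qed

text \<open>
  Rewards are uniformly bounded, so the series converges uniformly over the feasible set.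
\<close>

lemma continuous_on_objective:
  assumes d: "1 < d"
  shows "continuous_on (feasible E) (objective d E)"
proof -
  have s: "0 \<le> 1 / d" "1 / d < 1" using d by auto
  let ?f = "\<lambda>j x. (1 - 1 / d) * (1 / d) ^ j * reward E x j"
  have gain: "continuous_on (feasible E) (\<lambda>x. gain E (snd x j) a)" for j a
    unfolding gain_def
  proof (intro continuous_on_sum)
    fix b
    show "continuous_on (feasible E) (\<lambda>x. snd x j $ b $ a * ln (E $ b $ a / snd x j $ b $ a))"
      by (rule continuous_on_compose2[OF continuous_on_entropy_term[OF E_nonneg[of b a]]
            continuous_on_snd_coordinate])
        (auto intro: left_stochasticD(1) kernelsD(1) feasibleD(2))
  qed
  have "continuous_on (feasible E) (\<lambda>x. \<Sum>j. ?f j x)"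
  proof (rule uniform_limit_theorem)
    show "uniform_limit (feasible E) (\<lambda>n x. \<Sum>j<n. ?f j x) (\<lambda>x. \<Sum>j. ?f j x) sequentially"
    proof (rule Weierstrass_m_test)
      show "norm (?f j x) \<le> (1 - 1 / d) * (1 / d) ^ j * reward_bound" if "x \<in> feasible E" for j x
        using abs_reward_le[OF that, of j] s by (auto simp: abs_mult intro!: mult_left_mono)
      show "summable (\<lambda>j. (1 - 1 / d) * (1 / d) ^ j * reward_bound)"
        by (rule summable_abel_mean[OF s, of _ "\<bar>reward_bound\<bar>"]) simp
    qed
    show "\<forall>\<^sub>F n in sequentially. continuous_on (feasible E) (\<lambda>x. \<Sum>j<n. ?f j x)"
      unfolding reward_def
      by (intro always_eventually allI continuous_on_sum continuous_on_mult continuous_on_const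
          continuous_on_fst_coordinate gain)
  qed simp
  then show ?thesis
    using d by (simp add: objective_eq_abel_mean abel_mean_def cong: continuous_on_cong)
qed

text \<open>
  The supremum is a maximum: the objective is a continuous function on a compact set.
\<close>

lemma P_inf_eq_abel_sup:
  assumes d: "1 < d"
  shows "P_inf d E = abel_sup (1 / d)"
proof -
  have s: "0 \<le> 1 / d" "1 / d < 1" using d by auto
  have obj: "objective d E x = abel_mean (1 / d) (reward E x)" for x
    using d by (intro objective_eq_abel_mean) simp
  obtain x where x: "x \<in> feasible E" "\<And>y. y \<in> feasible E \<Longrightarrow> objective d E y \<le> objective d E x"
    using continuous_attains_sup[OF compact_feasible _ continuous_on_objective[OF d]] nonempty by auto
  have "P_inf d E = objective d E x"
    unfolding P_inf_def using x by (intro Greatest_equality) auto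
  also have "\<dots> = abel_sup (1 / d)"
  proof (rule antisym)
    show "objective d E x \<le> abel_sup (1 / d)"
      unfolding obj using x(1) by (intro abel_mean_le_sup[OF s]) simp
    show "abel_sup (1 / d) \<le> objective d E x"
      using x(2) by (intro abel_sup_le) (auto simp: obj)
  qed
  finally show ?thesis .
qed

lemma continuous_on_P_inf: "continuous_on {1<..} (\<lambda>d. P_inf d E)"
proof -
  have "continuous_on {1<..} (\<lambda>d. abel_sup (1 / d))"
    by (rule continuous_on_compose2[OF continuous_on_abel_sup]) (auto intro!: continuous_intros)
  then show ?thesis
    by (rule continuous_on_eq) (simp add: P_inf_eq_abel_sup)
qed

lemma mono_on_P_inf: "mono_on {1<..} (\<lambda>d. P_inf d E)"
  by (rule mono_onI) (auto simp: P_inf_eq_abel_sup intro!: abel_sup_antimono frac_le)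

end

section \<open>Growth of matrix powers and the spectral radius\<close>

abbreviation enum :: "nat \<Rightarrow> 'a::finite" where
  "enum \<equiv> from_nat_into UNIV"

text \<open>
  The matrix whose spectral radius is \<open>rho E\<close>. The lemmas below transport its spectrum and its powers
  back to the alphabet, so that the enumeration of the alphabet disappears.
\<close>

definition complex_mat :: "real ^ 'a ^ 'a::finite \<Rightarrow> complex mat" where
  "complex_mat E = mat CARD('a) CARD('a) (\<lambda>(i, j). complex_of_real (E $ enum i $ enum j))"

lemma rho_eq_spectral_radius: "rho E = spectral_radius (complex_mat E)"
  by (simp add: rho_def complex_mat_def)

lemma complex_mat_carrier [simp]:
  "complex_mat (E :: real ^ 'a ^ 'a::finite) \<in> carrier_mat CARD('a) CARD('a)"
  by (simp add: complex_mat_def)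

lemma complex_mat_dim [simp]:
  "dim_row (complex_mat (E :: real ^ 'a ^ 'a::finite)) = CARD('a)"
  "dim_col (complex_mat (E :: real ^ 'a ^ 'a::finite)) = CARD('a)"
  by (simp_all add: complex_mat_def)

lemma sum_enum: "(\<Sum>i<CARD('a). f (enum i)) = (\<Sum>a\<in>(UNIV :: 'a::finite set). f a)"
  by (rule sum.reindex_bij_betw) (rule bij_betw_from_nat_into_finite, simp)

lemma ex_enum: "\<exists>i<CARD('a). (a :: 'a::finite) = enum i"
  using bij_betw_from_nat_into_finite[of "UNIV :: 'a set"] by (auto simp: bij_betw_def)

lemma ex_function_enum:
  "\<exists>u :: 'a::finite \<Rightarrow> 'b. \<forall>i<CARD('a). u (enum i) = f i"
proof -
  have inj: "inj_on (enum :: nat \<Rightarrow> 'a) {..<CARD('a)}"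
    using bij_betw_from_nat_into_finite[of "UNIV :: 'a set"] by (auto simp: bij_betw_def)
  show ?thesis
    by (rule exI[of _ "\<lambda>a. f (the_inv_into {..<CARD('a)} enum a)"])
      (auto simp: the_inv_into_f_f[OF inj])
qed

lemma complex_mat_mult_vec_index:
  fixes E :: "real ^ 'a ^ 'a::finite"
  assumes "v \<in> carrier_vec CARD('a)" "\<And>i. i < CARD('a) \<Longrightarrow> vec_index v i = u (enum i)" "i < CARD('a)"
  shows "vec_index (complex_mat E *\<^sub>v v) i = (\<Sum>b\<in>UNIV. complex_of_real (E $ enum i $ b) * u b)"
proof -
  have "vec_index (complex_mat E *\<^sub>v v) i
      = (\<Sum>j<CARD('a). complex_of_real (E $ enum i $ enum j) * u (enum j))"
    using assms by (simp add: complex_mat_def scalar_prod_def atLeast0LessThan)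
  then show ?thesis by (simp add: sum_enum[of "\<lambda>b. complex_of_real (E $ enum i $ b) * u b"])
qed

lemma spectrum_complex_mat_iff:
  fixes E :: "real ^ 'a ^ 'a::finite"
  shows "k \<in> spectrum (complex_mat E) \<longleftrightarrow>
    (\<exists>u. u \<noteq> (\<lambda>_. 0) \<and> (\<forall>a. (\<Sum>b\<in>UNIV. complex_of_real (E $ a $ b) * u b) = k * u a))"
    (is "_ = ?R")
proof
  assume "k \<in> spectrum (complex_mat E)"
  then obtain v where v: "v \<in> carrier_vec CARD('a)" "v \<noteq> 0\<^sub>v CARD('a)"
      "complex_mat E *\<^sub>v v = k \<cdot>\<^sub>v v"
    unfolding spectrum_def eigenvalue_def eigenvector_def mem_Collect_eq complex_mat_dim
    by (elim exE conjE)
  obtain u :: "'a \<Rightarrow> complex" where u: "\<forall>i<CARD('a). u (enum i) = vec_index v i"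
    using ex_function_enum[of "vec_index v"] by blast
  have "u \<noteq> (\<lambda>_. 0)"
  proof
    assume "u = (\<lambda>_. 0)"
    then have "vec_index v i = 0" if "i < CARD('a)" for i
      using u that by metis
    then have "v = 0\<^sub>v CARD('a)" using v(1) by (intro eq_vecI) auto
    with v(2) show False by contradiction
  qed
  moreover have "(\<Sum>b\<in>UNIV. complex_of_real (E $ a $ b) * u b) = k * u a" for a
  proof -
    obtain i where i: "i < CARD('a)" "a = enum i" using ex_enum by blast
    have "(\<Sum>b\<in>UNIV. complex_of_real (E $ enum i $ b) * u b) = vec_index (k \<cdot>\<^sub>v v) i"
      using complex_mat_mult_vec_index[OF v(1) _ i(1), of u E] u v(3) by simp
    also have "\<dots> = k * u (enum i)" using i v(1) u by simp
    finally show ?thesis using i by simp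
  qed
  ultimately show ?R by (intro exI[of _ u] conjI allI)
next
  assume ?R
  then obtain u where u: "u \<noteq> (\<lambda>_. 0)"
      "\<And>a. (\<Sum>b\<in>UNIV. complex_of_real (E $ a $ b) * u b) = k * u a"
    by blast
  define v where "v = vec CARD('a) (\<lambda>i. u (enum i))"
  have v: "v \<in> carrier_vec CARD('a)" and vi: "\<And>i. i < CARD('a) \<Longrightarrow> vec_index v i = u (enum i)"
    by (auto simp: v_def)
  have "v \<noteq> 0\<^sub>v CARD('a)"
  proof
    assume "v = 0\<^sub>v CARD('a)"
    then have "u a = 0" for a
      using ex_enum[of a] vi by force
    with u(1) show False by blast
  qed
  moreover have "complex_mat E *\<^sub>v v = k \<cdot>\<^sub>v v"
  proof (rule eq_vecI)
    fix i assume "i < dim_vec (k \<cdot>\<^sub>v v)"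
    then have i: "i < CARD('a)" using v by simp
    then show "vec_index (complex_mat E *\<^sub>v v) i = vec_index (k \<cdot>\<^sub>v v) i"
      using complex_mat_mult_vec_index[OF v vi i, of E] u(2)[of "enum i"] v vi[OF i] by simp
  qed (use v in \<open>simp add: complex_mat_def\<close>)
  ultimately show "k \<in> spectrum (complex_mat E)"
    unfolding spectrum_def eigenvalue_def eigenvector_def mem_Collect_eq complex_mat_dim
    using v by blast
qed

lemma ex_peripheral_eigenvector:
  fixes E :: "real ^ 'a ^ 'a::finite"
  shows "\<exists>k u. norm k = rho E \<and> u \<noteq> (\<lambda>_. 0) \<and>
    (\<forall>a. (\<Sum>b\<in>UNIV. complex_of_real (E $ a $ b) * u b) = k * u a)"
proof -
  have "rho E \<in> norm ` spectrum (complex_mat E)"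
    unfolding rho_eq_spectral_radius
    by (rule spectral_radius_mem_max(1)[OF complex_mat_carrier]) simp
  then obtain k where k: "norm k = rho E" "k \<in> spectrum (complex_mat E)" by force
  from k(2) show ?thesis
    unfolding spectrum_complex_mat_iff
    by (elim exE) (rule exI[of _ k], rule exI, rule conjI[OF k(1)], assumption)
qed

lemma norm_eigenvalue_le_rho:
  fixes E :: "real ^ 'a ^ 'a::finite"
  assumes "k \<in> spectrum (complex_mat E)"
  shows "norm k \<le> rho E"
  unfolding rho_eq_spectral_radius
  by (rule spectral_radius_mem_max(2)[OF complex_mat_carrier]) (use assms in auto)

lemma rho_scaleR_le:
  fixes E :: "real ^ 'a ^ 'a::finite"
  assumes r: "r > 0"
  shows "rho (r *\<^sub>R E) \<le> r * rho E"
proof -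
  obtain k u where k: "norm k = rho (r *\<^sub>R E)" and u: "u \<noteq> (\<lambda>_. 0)"
      and ev: "\<forall>a. (\<Sum>b\<in>UNIV. complex_of_real ((r *\<^sub>R E) $ a $ b) * u b) = k * u a"
    using ex_peripheral_eigenvector[of "r *\<^sub>R E"] by (elim exE conjE) (rule that)
  have "(\<Sum>b\<in>UNIV. complex_of_real (E $ a $ b) * u b) = (k / of_real r) * u a" for a
  proof -
    have "of_real r * (\<Sum>b\<in>UNIV. complex_of_real (E $ a $ b) * u b) = k * u a"
      using spec[OF ev, of a] by (simp add: sum_distrib_left mult.assoc)
    then show ?thesis using r by (simp add: field_simps)
  qed
  then have "k / of_real r \<in> spectrum (complex_mat E)"
    unfolding spectrum_complex_mat_iff using u by (intro exI[of _ u] conjI allI)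
  then have "norm (k / of_real r) \<le> rho E" by (rule norm_eigenvalue_le_rho)
  then show ?thesis using r k by (simp add: norm_divide field_simps)
qed

fun power_column_sum :: "real ^ 'a ^ 'a::finite \<Rightarrow> nat \<Rightarrow> 'a \<Rightarrow> real" where
  "power_column_sum E 0 a = 1"
| "power_column_sum E (Suc n) a = (\<Sum>b\<in>UNIV. E $ b $ a * power_column_sum E n b)"

lemma power_column_sum_scaleR: "power_column_sum (r *\<^sub>R E) n a = r ^ n * power_column_sum E n a"
  by (induction n arbitrary: a) (simp_all add: sum_distrib_left mult_ac)

lemma power_column_sum_eq_mat_power:
  fixes E :: "real ^ 'a ^ 'a::finite"
  assumes "i < CARD('a)"
  shows "complex_of_real (power_column_sum E n (enum i))
    = (\<Sum>j<CARD('a). (complex_mat E ^\<^sub>m n) $$ (j, i))"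
  using assms
proof (induction n arbitrary: i)
  case 0
  then show ?case by (simp add: complex_mat_def)
next
  case (Suc n)
  let ?M = "complex_mat E" and ?N = "CARD('a)"
  have dims: "dim_row (?M ^\<^sub>m n) = ?N" "dim_col (?M ^\<^sub>m n) = ?N" "dim_row ?M = ?N" "dim_col ?M = ?N"
    using pow_carrier_mat[OF complex_mat_carrier[of E], of n] by (auto simp: complex_mat_def)
  have "(?M ^\<^sub>m Suc n) $$ (j, i) = (\<Sum>k<?N. (?M ^\<^sub>m n) $$ (j, k) * complex_of_real (E $ enum k $ enum i))"
    if "j < ?N" for j
    using that Suc.prems dims
    by (simp add: scalar_prod_def atLeast0LessThan) (simp add: complex_mat_def)
  then have "(\<Sum>j<?N. (?M ^\<^sub>m Suc n) $$ (j, i))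
      = (\<Sum>j<?N. \<Sum>k<?N. (?M ^\<^sub>m n) $$ (j, k) * complex_of_real (E $ enum k $ enum i))"
    by (intro sum.cong refl) simp
  also have "\<dots> = (\<Sum>k<?N. (\<Sum>j<?N. (?M ^\<^sub>m n) $$ (j, k)) * complex_of_real (E $ enum k $ enum i))"
    by (subst sum.swap) (simp add: sum_distrib_right)
  also have "\<dots> = (\<Sum>k<?N. complex_of_real (power_column_sum E n (enum k) * E $ enum k $ enum i))"
    by (intro sum.cong refl) (simp add: Suc.IH)
  also have "\<dots> = complex_of_real (\<Sum>k<?N. power_column_sum E n (enum k) * E $ enum k $ enum i)"
    by simp
  also have "(\<Sum>k<?N. power_column_sum E n (enum k) * E $ enum k $ enum i) = power_column_sum E (Suc n) (enum i)"
    by (simp add: sum_enum[of "\<lambda>b. power_column_sum E n b * E $ b $ enum i"] mult.commute)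
  finally show ?case by simp
qed

lemma power_column_sum_bounded:
  fixes E :: "real ^ 'a ^ 'a::finite"
  assumes "rho E < 1"
  shows "\<exists>c. \<forall>n a. \<bar>power_column_sum E n a\<bar> \<le> c"
proof -
  obtain c where c: "\<And>k. norm_bound (complex_mat E ^\<^sub>m k) c"
    using spectral_radius_jnf_norm_bound_less_1_upper_triangular[OF complex_mat_carrier[of E]]
      assms by (auto simp: rho_eq_spectral_radius)
  have "\<bar>power_column_sum E n a\<bar> \<le> real CARD('a) * c" for n a
  proof -
    obtain i where i: "i < CARD('a)" "a = enum i" using ex_enum by blast
    have dims: "dim_row (complex_mat E ^\<^sub>m n) = CARD('a)" "dim_col (complex_mat E ^\<^sub>m n) = CARD('a)"
      using pow_carrier_mat[OF complex_mat_carrier[of E], of n] by (simp_all only: carrier_matD)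
    have "\<bar>power_column_sum E n a\<bar> = norm (complex_of_real (power_column_sum E n a))" by simp
    also have "\<dots> = norm (\<Sum>j<CARD('a). (complex_mat E ^\<^sub>m n) $$ (j, i))"
      using power_column_sum_eq_mat_power[OF i(1), of E n] i(2) by simp
    also have "\<dots> \<le> of_nat (card {..<CARD('a)}) * c"
      using c[of n] i dims by (intro sum_norm_bound) (auto simp: norm_bound_def)
    finally show ?thesis by simp
  qed
  then show ?thesis by blast
qed

text \<open>
  The powers of a matrix of spectral radius below \<open>1\<close> are bounded, by its Jordan normal form. This is
  applied to \<open>E / r\<close>.
\<close>

lemma power_column_sum_le_geometric:
  fixes E :: "real ^ 'a ^ 'a::finite"
  assumes "rho E < r" "0 < r"
  shows "\<exists>c. \<forall>n a. power_column_sum E n a \<le> c * r ^ n"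
proof -
  have "rho ((1 / r) *\<^sub>R E) \<le> 1 / r * rho E"
    using assms by (intro rho_scaleR_le) simp
  also have "\<dots> < 1" using assms by simp
  finally obtain c where c: "\<And>n a. \<bar>power_column_sum ((1 / r) *\<^sub>R E) n a\<bar> \<le> c"
    using power_column_sum_bounded by blast
  have "power_column_sum E n a \<le> c * r ^ n" for n a
  proof -
    have "(1 / r) ^ n * power_column_sum E n a \<le> c"
      using c[of n a] unfolding power_column_sum_scaleR by linarith
    then show ?thesis using assms by (simp add: power_divide field_simps)
  qed
  then show ?thesis by blast
qed

context interaction_matrix
begin

lemma power_column_sum_pos: "0 < power_column_sum E n a"
  by (induction n arbitrary: a) (auto intro: weighted_column_pos)

lemma log_partition_eq_ln_power_column_sum: "log_partition E 1 n a = ln (power_column_sum E n a)"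
proof (induction n arbitrary: a)
  case (Suc n)
  then show ?case using power_column_sum_pos by simp
qed simp

lemma power_column_sum_le_exp_Max: "power_column_sum E n a \<le> exp (Max (range (log_partition E 1 n)))"
proof -
  have "log_partition E 1 n a \<le> Max (range (log_partition E 1 n))"
    by (rule Max_ge) simp_all
  then have "exp (log_partition E 1 n a) \<le> exp (Max (range (log_partition E 1 n)))"
    by simp
  then show ?thesis
    using power_column_sum_pos[of n a] by (simp add: log_partition_eq_ln_power_column_sum)
qed

text \<open>
  Take an eigenvector \<open>u\<close> for an eigenvalue of modulus \<open>rho E\<close>. The triangle inequality gives
  \<open>rho E \<bar>u\<bar> \<le> E \<bar>u\<bar>\<close> entrywise, hence \<open>(rho E)\<^sup>n \<bar>u\<bar> \<le> E\<^sup>n \<bar>u\<bar>\<close>, and summing over all entries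
  brings in the column sums of \<open>E\<^sup>n\<close>.
\<close>

lemma rho_power_le: "rho E ^ n \<le> exp (Max (range (log_partition E 1 n)))"
proof -
  obtain k u where k: "norm k = rho E" and u: "u \<noteq> (\<lambda>_. 0)"
      and ev: "\<forall>a. (\<Sum>b\<in>UNIV. complex_of_real (E $ a $ b) * u b) = k * u a"
    using ex_peripheral_eigenvector[of E] by (elim exE conjE) (rule that)
  have rho: "0 \<le> rho E" using k norm_ge_zero[of k] by simp
  have step: "rho E * norm (u a) \<le> (\<Sum>b\<in>UNIV. E $ a $ b * norm (u b))" for a
  proof -
    have "rho E * norm (u a) = norm (\<Sum>b\<in>UNIV. complex_of_real (E $ a $ b) * u b)"
      by (simp add: spec[OF ev] norm_mult k)
    also have "\<dots> \<le> (\<Sum>b\<in>UNIV. norm (complex_of_real (E $ a $ b) * u b))"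
      by (rule norm_sum)
    also have "\<dots> = (\<Sum>b\<in>UNIV. E $ a $ b * norm (u b))"
      using E_nonneg by (simp add: norm_mult)
    finally show ?thesis .
  qed
  have grow: "rho E ^ n * (\<Sum>a\<in>UNIV. norm (u a)) \<le> (\<Sum>a\<in>UNIV. power_column_sum E n a * norm (u a))"
  proof (induction n)
    case (Suc n)
    have "rho E ^ Suc n * (\<Sum>a\<in>UNIV. norm (u a)) \<le> rho E * (\<Sum>a\<in>UNIV. power_column_sum E n a * norm (u a))"
      using mult_left_mono[OF Suc rho] by (simp add: mult_ac)
    also have "\<dots> = (\<Sum>a\<in>UNIV. power_column_sum E n a * (rho E * norm (u a)))"
      by (simp add: sum_distrib_left mult_ac)
    also have "\<dots> \<le> (\<Sum>a\<in>UNIV. power_column_sum E n a * (\<Sum>b\<in>UNIV. E $ a $ b * norm (u b)))"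
      using step power_column_sum_pos by (intro sum_mono mult_left_mono) (auto simp: less_imp_le)
    also have "\<dots> = (\<Sum>b\<in>UNIV. \<Sum>a\<in>UNIV. power_column_sum E n a * (E $ a $ b * norm (u b)))"
      unfolding sum_distrib_left by (rule sum.swap)
    also have "\<dots> = (\<Sum>b\<in>UNIV. power_column_sum E (Suc n) b * norm (u b))"
      by (simp add: sum_distrib_left sum_distrib_right mult_ac)
    finally show ?case .
  qed simp
  have "\<dots> \<le> (\<Sum>a\<in>UNIV. exp (Max (range (log_partition E 1 n))) * norm (u a))"
    by (intro sum_mono mult_right_mono power_column_sum_le_exp_Max) simp
  then have "rho E ^ n * (\<Sum>a\<in>UNIV. norm (u a)) \<le> exp (Max (range (log_partition E 1 n))) * (\<Sum>a\<in>UNIV. norm (u a))"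
    using grow by (simp add: sum_distrib_left)
  moreover have "0 < (\<Sum>a\<in>UNIV. norm (u a))"
  proof -
    obtain a where "u a \<noteq> 0" using u by (auto simp: fun_eq_iff)
    then show ?thesis by (intro sum_pos2[of UNIV a]) auto
  qed
  ultimately show ?thesis by (rule mult_right_le_imp_le)
qed

text \<open>
  The column sums of \<open>E\<^sup>n\<close> are at least \<open>m\<^sup>n\<close>, where \<open>m > 0\<close> is the least column sum of \<open>E\<close>. If
  \<open>rho E\<close> were not positive, they would be at most a constant times \<open>(m / 2)\<^sup>n\<close>.
\<close>

lemma rho_pos: "0 < rho E"
proof (rule ccontr)
  assume neg: "\<not> 0 < rho E"
  define m where "m = Min (range (\<lambda>b. \<Sum>a\<in>UNIV. E $ a $ b))"
  have m_le: "m \<le> (\<Sum>a\<in>UNIV. E $ a $ b)" for b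
    unfolding m_def by (rule Min_le) simp_all
  have "m \<in> range (\<lambda>b. \<Sum>a\<in>UNIV. E $ a $ b)"
    unfolding m_def by (rule Min_in) simp_all
  then have m: "0 < m" using col_pos by auto
  have grow: "m ^ n \<le> power_column_sum E n a" for n a
  proof (induction n arbitrary: a)
    case (Suc n)
    have "m ^ Suc n \<le> (\<Sum>b\<in>UNIV. E $ b $ a) * m ^ n"
      using m_le[of a] m by (simp add: mult_right_mono)
    also have "\<dots> \<le> power_column_sum E (Suc n) a"
      using Suc E_nonneg by (simp add: sum_distrib_right sum_mono mult_left_mono)
    finally show ?case .
  qed simp
  have "rho E < m / 2" "0 < m / 2" using neg m by auto
  then obtain c where c: "\<And>n a. power_column_sum E n a \<le> c * (m / 2) ^ n"
    using power_column_sum_le_geometric by blast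
  have "2 ^ n \<le> c" for n :: nat
  proof -
    have "m ^ n \<le> c * (m / 2) ^ n" using grow c order_trans by blast
    then show ?thesis using m by (simp add: power_divide field_simps)
  qed
  moreover obtain n :: nat where "c < 2 ^ n"
    using real_arch_pow[of 2 c] by auto
  ultimately show False by (meson not_le)
qed

text \<open>
  Gelfand's formula for the largest column sum, in logarithmic form.
\<close>

lemma growth_rate:
  "(\<lambda>n. Max (range (log_partition E 1 n)) / real n) \<longlonglongrightarrow> ln (rho E)"
proof (rule order_tendstoI)
  fix a assume a: "a < ln (rho E)"
  have "a < Max (range (log_partition E 1 n)) / real n" if n: "n \<ge> 1" for n
  proof -
    have "ln (rho E ^ n) \<le> Max (range (log_partition E 1 n))"
      using ln_mono[OF rho_power_le[of n]] rho_pos by simp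
    then have "real n * ln (rho E) \<le> Max (range (log_partition E 1 n))"
      using rho_pos by (simp add: ln_realpow)
    then have "ln (rho E) \<le> Max (range (log_partition E 1 n)) / real n"
      using n by (simp add: field_simps)
    with a show ?thesis by simp
  qed
  then show "\<forall>\<^sub>F n in sequentially. a < Max (range (log_partition E 1 n)) / real n"
    by (rule eventually_sequentiallyI)
next
  fix a assume a: "ln (rho E) < a"
  \<comment> \<open>A number strictly between \<open>rho E\<close> and \<open>exp a\<close>.\<close>
  define r where "r = exp ((ln (rho E) + a) / 2)"
  have "rho E = exp (ln (rho E))" using rho_pos by simp
  also have "\<dots> < r" unfolding r_def using a by simp
  finally have r: "rho E < r" "0 < r" "ln r < a" using a by (auto simp: r_def)
  obtain c where c: "\<And>n a. power_column_sum E n a \<le> c * r ^ n"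
    using power_column_sum_le_geometric[OF r(1,2)] by blast
  have "1 \<le> c" using c[of 0] by simp
  have le: "Max (range (log_partition E 1 n)) / real n \<le> ln c / real n + ln r" if n: "n \<ge> 1" for n
  proof -
    have "log_partition E 1 n b \<le> ln c + real n * ln r" for b
    proof -
      have "ln (power_column_sum E n b) \<le> ln (c * r ^ n)"
        using c power_column_sum_pos by (meson ln_mono less_le_trans)
      then show ?thesis
        using \<open>1 \<le> c\<close> r(2) by (simp add: log_partition_eq_ln_power_column_sum ln_mult ln_realpow)
    qed
    then have "Max (range (log_partition E 1 n)) \<le> ln c + real n * ln r"
      by (intro Max.boundedI) auto
    then show ?thesis using n by (simp add: field_simps)
  qed
  have "(\<lambda>n. ln c / real n + ln r) \<longlonglongrightarrow> 0 + ln r"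
    by (intro tendsto_add lim_const_over_n tendsto_const)
  then have "\<forall>\<^sub>F n in sequentially. ln c / real n + ln r < a"
    using r(3) by (intro order_tendstoD(2)) auto
  then show "\<forall>\<^sub>F n in sequentially. Max (range (log_partition E 1 n)) / real n < a"
    using eventually_ge_at_top[of 1] by eventually_elim (use le in force)
qed

lemma P_inf_tendsto_ln_rho: "((\<lambda>d. P_inf d E) \<longlongrightarrow> ln (rho E)) (at_right 1)"
proof -
  have "(abel_sup \<longlongrightarrow> ln (rho E)) (at_left 1)"
  proof (rule abel_sup_tendsto_left_1[OF _ _ growth_rate])
    show "(\<Sum>j<N. h j) \<le> Max (range (log_partition E 1 N))" if "h \<in> reward E ` feasible E" for N h
      using that weighted_reward_le_Max[of _ 1 N] by auto
    show "\<exists>h\<in>reward E ` feasible E. (\<Sum>j<N. h j) = Max (range (log_partition E 1 N))" for N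
      using weighted_reward_Max_attained[of 1 N] by auto
  qed
  moreover have "filterlim (\<lambda>d :: real. 1 / d) (at_left 1) (at_right 1)"
    by real_asymp
  ultimately have "((\<lambda>d. abel_sup (1 / d)) \<longlongrightarrow> ln (rho E)) (at_right 1)"
    by (rule filterlim_compose)
  then show ?thesis
    by (rule Lim_transform_eventually)
      (auto simp: P_inf_eq_abel_sup eventually_at_filter)
qed

lemma P_inf_tendsto_ln_max_column_sum:
  "((\<lambda>d. P_inf d E) \<longlongrightarrow> ln (max_column_sum E)) at_top"
proof -
  have Max_eq: "Max (range (log_partition E 1 1)) = ln (max_column_sum E)"
  proof (rule Max_eqI)
    have "max_column_sum E \<in> range (\<lambda>b. \<Sum>a\<in>UNIV. E $ a $ b)"
      unfolding max_column_sum_def by (rule Max_in) simp_all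
    then show "ln (max_column_sum E) \<in> range (log_partition E 1 1)" by auto
    fix y assume "y \<in> range (log_partition E 1 1)"
    then obtain b where b: "y = ln (\<Sum>a\<in>UNIV. E $ a $ b)" by auto
    have "(\<Sum>a\<in>UNIV. E $ a $ b) \<le> max_column_sum E"
      unfolding max_column_sum_def by (rule Max_ge) simp_all
    then show "y \<le> ln (max_column_sum E)"
      unfolding b using col_pos[of b] less_le_trans[OF col_pos[of b]] by simp
  qed simp
  have "(abel_sup \<longlongrightarrow> ln (max_column_sum E)) (at_right 0)"
  proof (rule abel_sup_tendsto_right_0)
    show "h 0 \<le> ln (max_column_sum E)" if "h \<in> reward E ` feasible E" for h
      using that weighted_reward_le_Max[of _ 1 1] Max_eq by auto
    show "\<exists>h\<in>reward E ` feasible E. h 0 = ln (max_column_sum E)"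
      using weighted_reward_Max_attained[of 1 1] Max_eq by auto
  qed
  moreover have "filterlim (\<lambda>d :: real. 1 / d) (at_right 0) at_top"
    by real_asymp
  ultimately have "((\<lambda>d. abel_sup (1 / d)) \<longlongrightarrow> ln (max_column_sum E)) at_top"
    by (rule filterlim_compose)
  then show ?thesis
    by (rule Lim_transform_eventually)
      (use eventually_gt_at_top[of "1::real"] in eventually_elim, simp add: P_inf_eq_abel_sup)
qed

end

section \<open>Partition functions on the tree\<close>

lemma level_0: "level d 0 = {[]}"
  by (auto simp: level_def tree_def)

lemma level_Suc: "level d (Suc n) = (\<lambda>(g, i). g @ [i]) ` (level d n \<times> {1..d})"
proof (rule Set.set_eqI)
  fix h
  show "h \<in> level d (Suc n) \<longleftrightarrow> h \<in> (\<lambda>(g, i). g @ [i]) ` (level d n \<times> {1..d})"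
    by (cases h rule: rev_cases) (auto simp: level_def tree_def image_iff)
qed

lemma level_eq: "level d n = {xs. set xs \<subseteq> {1..d} \<and> length xs = n}"
  by (auto simp: level_def tree_def)

lemma finite_level: "finite (level d n)"
  unfolding level_eq by (rule finite_lists_length_eq) simp

lemma card_level: "card (level d n) = d ^ n"
  unfolding level_eq by (subst card_lists_length_eq) auto

lemma Delta_Suc: "Delta d (Suc n) = Delta d n \<union> level d (Suc n)"
  by (auto simp: Delta_def atMost_Suc)

lemma Delta_level_disjoint: "Delta d n \<inter> level d (Suc n) = {}"
  by (auto simp: Delta_def level_def)

lemma finite_Delta: "finite (Delta d n)"
  by (auto simp: Delta_def finite_level)

lemma card_Delta: "(real d - 1) * real (card (Delta d n)) = real d ^ Suc n - 1"
proof (induction n)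
  case 0
  then show ?case by (simp add: Delta_def level_0)
next
  case (Suc n)
  have "card (Delta d (Suc n)) = card (Delta d n) + d ^ Suc n"
    unfolding Delta_Suc
    by (subst card_Un_disjoint[OF finite_Delta finite_level Delta_level_disjoint]) (simp only: card_level)
  then show ?case using Suc by (simp add: algebra_simps)
qed

lemma prod_level_Suc: "(\<Prod>h\<in>level d (Suc n). F h) = (\<Prod>g\<in>level d n. \<Prod>i\<in>{1..d}. F (g @ [i]))"
proof -
  have inj: "inj_on (\<lambda>(g, i). g @ [i]) (level d n \<times> {1..d})"
    by (auto simp: inj_on_def)
  show ?thesis
    unfolding level_Suc prod.reindex[OF inj] prod.cartesian_product
    by (rule prod.cong) auto
qed

lemma sum_PiE_Un:
  assumes disjoint: "A \<inter> B = {}"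
  shows "(\<Sum>u\<in>PiE (A \<union> B) F. h u)
    = (\<Sum>u\<in>PiE A F. \<Sum>v\<in>PiE B F. h (\<lambda>x. if x \<in> A then u x else v x))"
proof -
  have "(\<Sum>u\<in>PiE (A \<union> B) F. h u)
      = (\<Sum>(u, v)\<in>PiE A F \<times> PiE B F. h (\<lambda>x. if x \<in> A then u x else v x))"
  proof (rule sum.reindex_bij_witness[where
        i = "\<lambda>(u, v) x. if x \<in> A then u x else v x" and j = "\<lambda>u. (restrict u A, restrict u B)"])
    fix u assume u: "u \<in> PiE (A \<union> B) F"
    show eq: "(\<lambda>(u, v) x. if x \<in> A then u x else v x) (restrict u A, restrict u B) = u"
    proof (rule ext)
      fix x
      show "(\<lambda>(u, v) x. if x \<in> A then u x else v x) (restrict u A, restrict u B) x = u x"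
        using PiE_arb[OF u, of x] by auto
    qed
    show "(restrict u A, restrict u B) \<in> PiE A F \<times> PiE B F"
      using u by auto
    show "(case (restrict u A, restrict u B) of (u, v) \<Rightarrow> h (\<lambda>x. if x \<in> A then u x else v x)) = h u"
      using eq by simp
  next
    fix p assume p: "p \<in> PiE A F \<times> PiE B F"
    obtain u v where uv: "p = (u, v)" "u \<in> PiE A F" "v \<in> PiE B F" using p by blast
    have "restrict (\<lambda>x. if x \<in> A then u x else v x) A = u"
      using PiE_arb[OF uv(2)] by (auto simp: restrict_def fun_eq_iff)
    moreover have "restrict (\<lambda>x. if x \<in> A then u x else v x) B = v"
      using PiE_arb[OF uv(3)] disjoint by (auto simp: restrict_def fun_eq_iff)
    ultimately show "(restrict ((\<lambda>(u, v) x. if x \<in> A then u x else v x) p) A,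
        restrict ((\<lambda>(u, v) x. if x \<in> A then u x else v x) p) B) = p"
      by (simp add: uv(1))
    show "(\<lambda>(u, v) x. if x \<in> A then u x else v x) p \<in> PiE (A \<union> B) F"
      using uv disjoint by (auto simp: PiE_iff extensional_def)
  qed
  then show ?thesis by (simp add: sum.cartesian_product)
qed

text \<open>
  The product over all edges of the ball of radius \<open>n\<close>, grouped by parent as in the partition function.
\<close>

definition interaction_weight ::
    "nat \<Rightarrow> real ^ 'a ^ 'a::finite \<Rightarrow> nat \<Rightarrow> (nat list \<Rightarrow> 'a) \<Rightarrow> real" where
  "interaction_weight d E n u = (\<Prod>g\<in>(\<Union>k<n. level d k). \<Prod>i\<in>{1..d}. E $ u (g @ [i]) $ u g)"

lemma interaction_weight_Suc:
  "interaction_weight d E (Suc n) u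
     = interaction_weight d E n u * (\<Prod>h\<in>level d (Suc n). E $ u h $ u (butlast h))"
proof -
  have "(\<Union>k<Suc n. level d k) = (\<Union>k<n. level d k) \<union> level d n"
    by (auto simp: lessThan_Suc)
  moreover have "(\<Union>k<n. level d k) \<inter> level d n = {}"
    by (auto simp: level_def)
  ultimately show ?thesis
    by (simp add: interaction_weight_def prod.union_disjoint finite_level prod_level_Suc)
qed

lemma interaction_weight_cong:
  assumes "\<And>g. g \<in> Delta d n \<Longrightarrow> u g = v g"
  shows "interaction_weight d E n u = interaction_weight d E n v"
  unfolding interaction_weight_def
proof (intro prod.cong refl)
  fix g i assume g: "g \<in> (\<Union>k<n. level d k)" and i: "i \<in> {1..d}"
  then obtain k where "k < n" "g \<in> level d k" by blast
  then have "g \<in> Delta d n" "g @ [i] \<in> Delta d n"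
    using i by (auto simp: Delta_def level_def tree_def intro!: exI[of _ "Suc k"] bexI[of _ "Suc k"])
  then show "E $ u (g @ [i]) $ u g = E $ v (g @ [i]) $ v g" using assms by simp
qed

text \<open>
  The factor that the \<open>d\<close> children of a vertex with symbol \<open>a\<close> contribute when each child with symbol
  \<open>b\<close> carries the weight \<open>\<phi> b\<close>.
\<close>

definition subtree_update :: "nat \<Rightarrow> real ^ 'a ^ 'a::finite \<Rightarrow> ('a \<Rightarrow> real) \<Rightarrow> 'a \<Rightarrow> real" where
  "subtree_update d E \<phi> a = (\<Sum>b\<in>UNIV. E $ b $ a * \<phi> b) ^ d"

text \<open>
  A partition function with a boundary weight \<open>\<phi>\<close> on the leaves, summed over all colourings of the
  ball. The boundary weight is what makes an induction over the height possible.
\<close>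

definition boundary_partition ::
    "nat \<Rightarrow> real ^ 'a \<Rightarrow> real ^ 'a ^ 'a::finite \<Rightarrow> ('a \<Rightarrow> real) \<Rightarrow> nat \<Rightarrow> real" where
  "boundary_partition d w E \<phi> n = (\<Sum>u\<in>Delta d n \<rightarrow>\<^sub>E UNIV.
     w $ u [] * interaction_weight d E n u * (\<Prod>g\<in>level d n. \<phi> (u g)))"

lemma boundary_partition_0: "boundary_partition d w E \<phi> 0 = (\<Sum>a\<in>UNIV. w $ a * \<phi> a)"
proof -
  have "boundary_partition d w E \<phi> 0 = (\<Sum>u\<in>{[] :: nat list} \<rightarrow>\<^sub>E UNIV. w $ u [] * \<phi> (u []))"
    by (simp add: boundary_partition_def interaction_weight_def Delta_def level_0)
  also have "\<dots> = (\<Sum>a\<in>UNIV. w $ a * \<phi> a)"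
    by (rule sum.reindex_bij_witness[where j = "\<lambda>u. u []" and i = "\<lambda>a. restrict (\<lambda>_. a) {[]}"])
      (auto simp: PiE_iff extensional_def fun_eq_iff)
  finally show ?thesis .
qed

text \<open>
  Given the colouring of the inner ball, the leaves are independent: the sum over their colourings
  factorises, and every vertex of the last inner level receives one factor from each of its \<open>d\<close>
  children.
\<close>

lemma boundary_partition_Suc:
  fixes E :: "real ^ 'a ^ 'a::finite"
  shows "boundary_partition d w E \<phi> (Suc n) = boundary_partition d w E (subtree_update d E \<phi>) n"
proof -
  let ?L = "level d (Suc n)"
  let ?join = "\<lambda>u v g. if g \<in> Delta d n then u g else v g"
  have summand: "w $ ?join u v [] * interaction_weight d E (Suc n) (?join u v)
        * (\<Prod>g\<in>?L. \<phi> (?join u v g))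
      = w $ u [] * interaction_weight d E n u * (\<Prod>h\<in>?L. E $ v h $ u (butlast h) * \<phi> (v h))"
    for u v :: "nat list \<Rightarrow> 'a"
  proof -
    have "[] \<in> Delta d n" by (auto simp: Delta_def level_def tree_def)
    moreover have "interaction_weight d E n (?join u v) = interaction_weight d E n u"
      by (rule interaction_weight_cong) simp
    moreover have "(\<Prod>h\<in>?L. E $ ?join u v h $ ?join u v (butlast h)) = (\<Prod>h\<in>?L. E $ v h $ u (butlast h))"
    proof (rule prod.cong[OF refl])
      fix h assume h: "h \<in> ?L"
      then have "h \<notin> Delta d n" using Delta_level_disjoint by blast
      moreover have "butlast h \<in> Delta d n"
        using h unfolding level_Suc by (auto simp: Delta_def)
      ultimately show "E $ ?join u v h $ ?join u v (butlast h) = E $ v h $ u (butlast h)" by simp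
    qed
    moreover have "(\<Prod>h\<in>?L. \<phi> (?join u v h)) = (\<Prod>h\<in>?L. \<phi> (v h))"
      by (rule prod.cong[OF refl]) (use Delta_level_disjoint in auto)
    ultimately show ?thesis
      by (simp add: interaction_weight_Suc prod.distrib mult_ac)
  qed
  have leaves: "(\<Sum>v\<in>?L \<rightarrow>\<^sub>E UNIV. \<Prod>h\<in>?L. E $ v h $ u (butlast h) * \<phi> (v h))
      = (\<Prod>g\<in>level d n. subtree_update d E \<phi> (u g))" for u :: "nat list \<Rightarrow> 'a"
  proof -
    have "(\<Sum>v\<in>?L \<rightarrow>\<^sub>E UNIV. \<Prod>h\<in>?L. E $ v h $ u (butlast h) * \<phi> (v h))
        = (\<Prod>h\<in>?L. \<Sum>b\<in>UNIV. E $ b $ u (butlast h) * \<phi> b)"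
      by (rule prod_sum_PiE[symmetric]) (simp_all add: finite_level)
    also have "\<dots> = (\<Prod>g\<in>level d n. subtree_update d E \<phi> (u g))"
      by (simp add: prod_level_Suc subtree_update_def)
    finally show ?thesis .
  qed
  have "boundary_partition d w E \<phi> (Suc n)
      = (\<Sum>u\<in>Delta d n \<rightarrow>\<^sub>E UNIV. \<Sum>v\<in>?L \<rightarrow>\<^sub>E UNIV.
          w $ u [] * interaction_weight d E n u * (\<Prod>h\<in>?L. E $ v h $ u (butlast h) * \<phi> (v h)))"
    unfolding boundary_partition_def Delta_Suc sum_PiE_Un[OF Delta_level_disjoint] summand ..
  also have "\<dots> = boundary_partition d w E (subtree_update d E \<phi>) n"
    unfolding sum_distrib_left[symmetric] leaves boundary_partition_def ..
  finally show ?thesis .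
qed

lemma boundary_partition_eq:
  "boundary_partition d w E \<phi> n = (\<Sum>a\<in>UNIV. w $ a * (subtree_update d E ^^ n) \<phi> a)"
proof (induction n arbitrary: \<phi>)
  case 0
  then show ?case by (simp add: boundary_partition_0)
next
  case (Suc n)
  then show ?case by (simp add: boundary_partition_Suc funpow_swap1)
qed

context interaction_matrix
begin

lemma subtree_update_funpow: "(subtree_update d E ^^ n) (\<lambda>_. 1) a = exp (log_partition E (real d) n a)"
proof (induction n arbitrary: a)
  case (Suc n)
  have "(subtree_update d E ^^ Suc n) (\<lambda>_. 1) a = subtree_update d E ((subtree_update d E ^^ n) (\<lambda>_. 1)) a"
    by simp
  also have "\<dots> = (\<Sum>b\<in>UNIV. E $ b $ a * exp (log_partition E (real d) n b)) ^ d"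
    by (subst subtree_update_def) (simp only: Suc)
  also have "\<dots> = exp (log_partition E (real d) (Suc n) a)"
    using weighted_column_pos[of "\<lambda>b. exp (log_partition E (real d) n b)" a]
    by (simp add: exp_of_nat_mult)
  finally show ?case .
qed simp

text \<open>
  A colouring of the ball without forbidden edges extends to the whole tree, because every symbol has
  an admissible successor; beyond the ball each vertex takes the successor of its parent's symbol.
  Hence colourings that are not restrictions of elements of the tree-shift have weight zero, and
  including them does not change the partition function.
\<close>

lemma restriction_of_axial_product:
  assumes u: "u \<in> Delta d n \<rightarrow>\<^sub>E UNIV" and pos: "interaction_weight d E n u \<noteq> 0"
  shows "u \<in> (\<lambda>x. restrict x (Delta d n)) ` axial_product d E"
proof -
  obtain succ where succ: "0 < E $ succ a $ a" for a
    using ex_successor by metis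
  \<comment> \<open>Every letter beyond the first \<open>n\<close> applies \<open>succ\<close> once.\<close>
  define ext where "ext g = (succ ^^ (length g - n)) (u (take n g))" for g
  define x where "x = restrict ext (tree d)"
  have ext_small: "ext g = u g" if "length g \<le> n" for g
    using that by (simp add: ext_def)
  have edge: "0 < E $ ext (g @ [i]) $ ext g" if g: "g \<in> tree d" and i: "i \<in> {1..d}" for g i
  proof (cases "length g < n")
    case True
    have "g \<in> (\<Union>k<n. level d k)" using True g by (auto simp: level_def)
    moreover have "finite (\<Union>k<n. level d k)" by (simp add: finite_level)
    ultimately have "(\<Prod>i\<in>{1..d}. E $ u (g @ [i]) $ u g) \<noteq> 0"
      using pos unfolding interaction_weight_def by (meson prod_zero)
    then have "E $ u (g @ [i]) $ u g \<noteq> 0"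
      using i by (meson finite_atLeastAtMost prod_zero)
    then have "0 < E $ u (g @ [i]) $ u g"
      using E_nonneg[of "u (g @ [i])" "u g"] by simp
    then show ?thesis using True by (simp add: ext_small)
  next
    case False
    then have "ext (g @ [i]) = succ (ext g)" by (simp add: ext_def Suc_diff_le)
    then show ?thesis using succ by simp
  qed
  have "(\<lambda>k. x (g @ replicate k i)) \<in> shift_space E" if g: "g \<in> tree d" and i: "i \<in> {1..d}" for g i
    unfolding shift_space_def
  proof (intro CollectI allI)
    fix k
    have "g @ replicate k i \<in> tree d" "g @ replicate (k + 1) i \<in> tree d"
      using g i by (auto simp: tree_def)
    moreover have "g @ replicate (k + 1) i = (g @ replicate k i) @ [i]"
      by (simp add: replicate_append_same)
    ultimately show "0 < E $ x (g @ replicate (k + 1) i) $ x (g @ replicate k i)"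
      using edge[of "g @ replicate k i" i] i by (simp add: x_def)
  qed
  then have "x \<in> axial_product d E"
    by (auto simp: axial_product_def x_def)
  moreover have "u = restrict x (Delta d n)"
  proof (rule ext)
    fix g
    show "u g = restrict x (Delta d n) g"
    proof (cases "g \<in> Delta d n")
      case True
      then have "g \<in> tree d" "length g \<le> n" by (auto simp: Delta_def level_def)
      then show ?thesis using True by (simp add: x_def ext_small)
    next
      case False
      then show ?thesis using PiE_arb[OF u False] by simp
    qed
  qed
  ultimately show ?thesis by blast
qed

lemma partition_function_eq:
  "partition_function d w E n = (\<Sum>a\<in>UNIV. w $ a * exp (log_partition E (real d) n a))"
proof -
  have "partition_function d w E n = boundary_partition d w E (\<lambda>_. 1) n"
    unfolding partition_function_def boundary_partition_def interaction_weight_def[symmetric]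
      prod.neutral_const mult_1_right
  proof (rule sum.mono_neutral_left)
    show "finite (Delta d n \<rightarrow>\<^sub>E (UNIV :: 'a set))"
      by (intro finite_PiE finite_Delta) simp
    show "(\<lambda>x. restrict x (Delta d n)) ` axial_product d E \<subseteq> Delta d n \<rightarrow>\<^sub>E UNIV"
      by auto
    show "\<forall>u\<in>(Delta d n \<rightarrow>\<^sub>E UNIV) - (\<lambda>x. restrict x (Delta d n)) ` axial_product d E.
        w $ u [] * interaction_weight d E n u = 0"
      using restriction_of_axial_product by (metis DiffE mult_zero_right)
  qed
  also have "\<dots> = (\<Sum>a\<in>UNIV. w $ a * exp (log_partition E (real d) n a))"
    unfolding boundary_partition_eq subtree_update_funpow ..
  finally show ?thesis .
qed

text \<open>
  The first \<open>n\<close> terms of the Abel mean are, up to the factor \<open>(d - 1) / d\<^bsup>n+1\<^esup>\<close>, the weighted reward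
  whose maximum is known from dynamic programming. The remaining terms form an Abel mean of a shifted
  reward sequence, multiplied by \<open>d\<^bsup>-n\<^esup>\<close>.
\<close>

lemma abel_sup_approximation:
  assumes d: "1 < d"
  shows "\<bar>abel_sup (1 / d) - (d - 1) / d ^ Suc n * Max (range (log_partition E d n))\<bar>
    \<le> reward_bound / d ^ n"
proof -
  have s: "0 \<le> 1 / d" "1 / d < 1" using d by auto
  let ?m = "Max (range (log_partition E d n))"
  have split: "\<bar>abel_mean (1 / d) (reward E x)
      - (d - 1) / d ^ Suc n * (\<Sum>j<n. d ^ (n - j) * reward E x j)\<bar> \<le> reward_bound / d ^ n"
    if x: "x \<in> feasible E" for x
  proof -
    have weight: "(1 - 1 / d) * (1 / d) ^ j * y = (d - 1) / d ^ Suc n * (d ^ (n - j) * y)"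
      if "j < n" for j y
    proof -
      have "d ^ n = d ^ (n - j) * d ^ j" using that by (simp add: power_add[symmetric])
      then show ?thesis using d by (simp add: power_divide field_simps)
    qed
    have "(\<Sum>j<n. (1 - 1 / d) * (1 / d) ^ j * reward E x j)
        = (d - 1) / d ^ Suc n * (\<Sum>j<n. d ^ (n - j) * reward E x j)"
      unfolding sum_distrib_left by (intro sum.cong refl weight) simp
    then have "abel_mean (1 / d) (reward E x) - (d - 1) / d ^ Suc n * (\<Sum>j<n. d ^ (n - j) * reward E x j)
        = (1 / d) ^ n * abel_mean (1 / d) (\<lambda>j. reward E x (n + j))"
      using abel_mean_split[of "1 / d" "reward E x" reward_bound n, OF s abs_reward_le[OF x]] by simp
    moreover have "\<bar>abel_mean (1 / d) (\<lambda>j. reward E x (n + j))\<bar> \<le> reward_bound"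
      by (rule abs_abel_mean_le[OF s abs_reward_le[OF x]])
    ultimately show ?thesis
      using d by (simp add: abs_mult power_divide divide_right_mono)
  qed
  have pos: "0 \<le> (d - 1) / d ^ Suc n" using d by simp
  have "abel_sup (1 / d) \<le> (d - 1) / d ^ Suc n * ?m + reward_bound / d ^ n"
  proof (rule abel_sup_le)
    fix h assume "h \<in> reward E ` feasible E"
    then obtain x where x: "x \<in> feasible E" "h = reward E x" by blast
    have "(d - 1) / d ^ Suc n * (\<Sum>j<n. d ^ (n - j) * reward E x j) \<le> (d - 1) / d ^ Suc n * ?m"
      using weighted_reward_le_Max[OF x(1)] d pos by (intro mult_left_mono) auto
    then show "abel_mean (1 / d) h \<le> (d - 1) / d ^ Suc n * ?m + reward_bound / d ^ n"
      using split[OF x(1)] unfolding x(2) by linarith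
  qed
  moreover obtain x where x: "x \<in> feasible E" "(\<Sum>j<n. d ^ (n - j) * reward E x j) = ?m"
    using weighted_reward_Max_attained[of d n] by blast
  then have "(d - 1) / d ^ Suc n * ?m - reward_bound / d ^ n \<le> abel_sup (1 / d)"
    using split[OF x(1)] abel_mean_le_sup[OF s imageI[OF x(1)]] unfolding x(2) by linarith
  ultimately show ?thesis by linarith
qed

text \<open>
  The partition function is the \<open>w\<close>-weighted sum of the finitely many numbers \<open>exp (L\<^sub>n a)\<close>, and is
  therefore comparable to the largest of them, uniformly in \<open>n\<close>.
\<close>

lemma ln_partition_function_bounds:
  assumes w: "\<And>a. 0 < w $ a"
  shows "\<exists>K. \<forall>n. \<bar>ln (partition_function d w E n) - Max (range (log_partition E (real d) n))\<bar> \<le> K"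
proof -
  define W where "W = (\<Sum>a\<in>UNIV. w $ a)"
  define v where "v = Min (range (\<lambda>a. w $ a))"
  have v_le: "v \<le> w $ a" for a unfolding v_def by (rule Min_le) simp_all
  have "v \<in> range (\<lambda>a. w $ a)" unfolding v_def by (rule Min_in) simp_all
  then have v: "0 < v" using w by auto
  have "v \<le> W" unfolding W_def using v_le w
    by (meson UNIV_I finite less_imp_le member_le_sum order_trans)
  then have W: "0 < W" using v by simp
  have "\<bar>ln (partition_function d w E n) - Max (range (log_partition E (real d) n))\<bar> \<le> \<bar>ln v\<bar> + \<bar>ln W\<bar>" for n
  proof -
    define m where "m = Max (range (log_partition E (real d) n))"
    let ?Z = "partition_function d w E n"
    have "m \<in> range (log_partition E (real d) n)" unfolding m_def by (rule Max_in) simp_all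
    then obtain a where a: "m = log_partition E (real d) n a" by blast
    have "v * exp m \<le> w $ a * exp (log_partition E (real d) n a)"
      unfolding a using v_le by (intro mult_right_mono) auto
    also have "\<dots> \<le> ?Z"
      unfolding partition_function_eq using w
      by (intro member_le_sum[of a UNIV "\<lambda>a. w $ a * exp (log_partition E (real d) n a)"])
        (auto intro: mult_nonneg_nonneg less_imp_le)
    finally have lower: "v * exp m \<le> ?Z" .
    have upper: "?Z \<le> W * exp m"
      unfolding partition_function_eq W_def sum_distrib_right
    proof (rule sum_mono)
      fix b :: 'a
      have "log_partition E (real d) n b \<le> m" unfolding m_def by (rule Max_ge) simp_all
      then show "w $ b * exp (log_partition E (real d) n b) \<le> w $ b * exp m"
        using w[of b] by (intro mult_left_mono) auto
    qed
    have vm: "0 < v * exp m" using v by simp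
    then have Z: "0 < ?Z" using lower by linarith
    have "ln v + m \<le> ln ?Z"
      using ln_le_cancel_iff[OF vm Z] lower v by (simp add: ln_mult)
    moreover have "ln ?Z \<le> ln W + m"
      using ln_le_cancel_iff[OF Z, of "W * exp m"] upper W by (simp add: ln_mult)
    ultimately show ?thesis unfolding m_def[symmetric] by linarith
  qed
  then show ?thesis by blast
qed

text \<open>
  Since \<open>(d - 1) \<bar>\<Delta>\<^sub>n\<bar> = d\<^bsup>n+1\<^esup> - 1\<close>, dividing by \<open>\<bar>\<Delta>\<^sub>n\<bar>\<close> amounts asymptotically to multiplying by
  \<open>(d - 1) / d\<^bsup>n+1\<^esup>\<close>, the normalisation of the truncated Abel mean.
\<close>

lemma pressure_eq_P_inf:
  assumes w: "\<And>a. 0 < w $ a" and d: "2 \<le> d"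
  shows "pressure d w E = P_inf (real d) E"
proof -
  let ?Z = "\<lambda>n. ln (partition_function d w E n)"
  let ?m = "\<lambda>n. Max (range (log_partition E (real d) n))"
  have d1: "1 < real d" using d by simp
  have triangle: "\<bar>x - z\<bar> \<le> a + b" if "\<bar>x - y\<bar> \<le> a" "\<bar>z - y\<bar> \<le> b" for x y z a b :: real
    using that by linarith
  obtain K where K: "\<And>n. \<bar>?Z n - ?m n\<bar> \<le> K"
    using ln_partition_function_bounds[OF w] by blast
  have geo: "(\<lambda>n. c / real d ^ n) \<longlonglongrightarrow> 0" for c
    using tendsto_mult[OF tendsto_const[of c] LIMSEQ_inverse_realpow_zero[OF d1]]
    by (simp add: divide_inverse)
  have "(\<lambda>n. (real d - 1) / real d ^ Suc n * ?Z n - abel_sup (1 / real d)) \<longlonglongrightarrow> 0"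
  proof (rule Lim_null_comparison)
    show "\<forall>\<^sub>F n in sequentially. norm ((real d - 1) / real d ^ Suc n * ?Z n - abel_sup (1 / real d))
        \<le> (K + reward_bound) / real d ^ n"
    proof (intro always_eventually allI)
      fix n
      let ?c = "(real d - 1) / real d ^ Suc n"
      have c: "0 \<le> ?c" "?c \<le> 1 / real d ^ n" using d1 by (auto simp: field_simps)
      have "\<bar>?c * ?Z n - ?c * ?m n\<bar> = ?c * \<bar>?Z n - ?m n\<bar>"
        unfolding right_diff_distrib[symmetric] abs_mult abs_of_nonneg[OF c(1)] ..
      also have "\<dots> \<le> K / real d ^ n"
        using mult_mono[OF c(2) K[of n]] d1 by simp
      finally show "norm (?c * ?Z n - abel_sup (1 / real d)) \<le> (K + reward_bound) / real d ^ n"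
        using abel_sup_approximation[OF d1, of n]
        unfolding real_norm_def add_divide_distrib by (rule triangle)
    qed
  qed (rule geo)
  then have lim: "(\<lambda>n. (real d - 1) / real d ^ Suc n * ?Z n) \<longlonglongrightarrow> abel_sup (1 / real d)"
    by (simp add: LIM_zero_iff)
  have "(\<lambda>n. 1 - (1 / real d) / real d ^ n) \<longlonglongrightarrow> 1 - 0"
    by (intro tendsto_diff tendsto_const geo)
  from tendsto_divide[OF lim this]
  have "(\<lambda>n. (real d - 1) / real d ^ Suc n * ?Z n / (1 - (1 / real d) / real d ^ n))
      \<longlonglongrightarrow> abel_sup (1 / real d)" by simp
  moreover have "(real d - 1) / real d ^ Suc n * ?Z n / (1 - (1 / real d) / real d ^ n)
      = ?Z n / real (card (Delta d n))" for n
  proof -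
    have card: "real (card (Delta d n)) = (real d ^ Suc n - 1) / (real d - 1)"
      using card_Delta[of d n] d1 by (simp add: field_simps)
    have "1 < real d ^ Suc n" using d1 by (rule one_less_power) simp
    then show ?thesis unfolding card using d1 by (simp add: field_simps)
  qed
  ultimately have "(\<lambda>n. ?Z n / real (card (Delta d n))) \<longlonglongrightarrow> abel_sup (1 / real d)"
    by simp
  then show ?thesis
    unfolding pressure_def using P_inf_eq_abel_sup[OF d1] by (simp add: limI)
qed

end

theorem theorem1:
  fixes w :: "real ^ 'a::finite" and A E :: "real ^ 'a ^ 'a"
  assumes w_nonneg: "\<And>a. w $ a \<ge> 0"
    and A_nonneg: "\<And>a b. A $ a $ b \<ge> 0"
    and E_eq: "\<And>a b. E $ a $ b = w $ a * A $ a $ b"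
    and col_pos: "\<And>b. (\<Sum>a\<in>UNIV. E $ a $ b) > 0"
    and row_pos: "\<And>a. (\<Sum>b\<in>UNIV. E $ a $ b) > 0"
  shows "continuous_on {1<..} (\<lambda>d. P_inf d E) \<and> mono_on {1<..} (\<lambda>d. P_inf d E)
    \<and> (\<forall>d::nat. d \<ge> 2 \<longrightarrow> P_inf (real d) E = pressure d w E)
    \<and> ((\<lambda>d. P_inf d E) \<longlongrightarrow> ln (rho E)) (at_right 1)
    \<and> ((\<lambda>d. P_inf d E) \<longlongrightarrow> ln (max_column_sum E)) at_top"
proof -
  interpret interaction_matrix E
    using w_nonneg A_nonneg E_eq col_pos row_pos by unfold_locales auto
  (* A vanishing weight would make a whole row of E vanish. *)
  have "0 < w $ a" for a
  proof (rule ccontr)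
    assume "\<not> 0 < w $ a"
    then have "w $ a = 0" using w_nonneg[of a] by simp
    then have "(\<Sum>b\<in>UNIV. E $ a $ b) = 0" by (simp add: E_eq)
    then show False using row_pos[of a] by simp
  qed
  then show ?thesis
    using continuous_on_P_inf mono_on_P_inf pressure_eq_P_inf P_inf_tendsto_ln_rho
      P_inf_tendsto_ln_max_column_sum
    by (intro conjI allI impI) auto
qed

end
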